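(* Let $n,m,d\ge1$ be integers, let $\lambda=(\lambda_1,\dots,\lambda_n)\in\mathbb C^n$, and for $t\in\mathbb C^m$ consider the germ at $0\in\mathbb C^n$ of holomorphic vector field $$\dot z_j=\lambda_jz_j+\sum_{i\in\mathbb N^m,\ 1\le|i|\le d}t^if_{j,i}(z),\qquad 1\le j\le n,$$ where the $f_{j,i}$ are germs of holomorphic functions at $0$ vanishing to order at least $2$. Assume that $0$ belongs to the convex hull of $\{\lambda_1,\dots,\lambda_n\}$ (Siegel domain), that the linear part is resonant, and that its resonances are generated by finitely many nonzero $r_1,\dots,r_l\in\mathbb N^n$ with $(r_s,\lambda)=0$ for $1\le s\le l$. Let $(h_t)_{t\in\mathbb C^m}$ be a family of formal normalizations with polynomial dependence on $t$: $w=h_t(z)$ is a formal change of variables with $h_t(0)=0$, $D_0h_t=I$, transforming the system into $$\dot w_i=\lambda_iw_i+g_{i,t}(w),\qquad g_{i,t}(w)=\sum_{s=1}^{l}g_{i,s,t}(w)\,w^{r_s},\qquad 1\le i\le n,$$ with formal power series $g_{i,s,t}$ such that $g_{i,s,t}(0)=0$ whenever $\|r_s\|=1$, and the coefficients of the monomials in $z$ of total degree $k$ in $h_t$ are polynomials in $t$ of degree at most $C_0+C_1k$ for some constants $C_0,C_1>0$. Then one of the following two alternatives holds: 1) For all $t\in\mathbb C^m$ the formal normalization $h_t$ converges near $0$, and thus the submanifold $\{w^{r_1}=0,\dots,w^{r_l}=0\}$ is invariant. 2) There is a set $E\subset\mathbb C^m$ of $\Gamma$-capacity $0$ such that $h_t$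 diverges for every $t\in\mathbb C^m\setminus E$.
   Context: Notation: $(r,\lambda)=\sum_k r_k\lambda_k$, $\|r\|=\sum_kr_k$, $w^r=\prod_kw_k^{r_k}$, for $r\in\mathbb N^n$; $|i|=i_1+\dots+i_m$ and $t^i=t_1^{i_1}\cdots t_m^{i_m}$. A resonance is a relation $(q,\lambda)=\lambda_j$ with $q\in\mathbb N^n$, $\|q\|\ge2$, $1\le j\le n$; the linear part is resonant if one exists. The resonances are generated by $r_1,\dots,r_l$ if every such $q$ is of the form $q=e_j+\sum_sk_sr_s$ with $k_s\in\mathbb N$, $e_j$ being the $j$-th standard basis vector. "Diverges" means converges in no neighbourhood of $0$. $\Gamma$-capacity: for $E\subset\mathbb C$, $\mathrm{Cap}(E)$ is the logarithmic capacity, $\mathrm{Cap}(E)=\sup_\mu e^{I(\mu)}$, with $I(\mu)=\iint\log|z-w|\,d\mu(z)d\mu(w)$ and $\mu$ ranging over Borel probability measures with compact support in $E$ (with $\mathrm{Cap}(\emptyset)=0$). For $E\subset\mathbb C^m$, $m\ge2$, let $\Gamma_m^{m-1}(E)$ be the set of $z\in\mathbb C^{m-1}$ such that $\{w\in\mathbb C:(z,w)\in E\}$ has positive capacity, and let $\Gamma_m^1(E)=\Gamma_2^1\circ\Gamma_3^2\circ\cdots\circ\Gamma_m^{m-1}(E)\subset\mathbb C$ (with $\Gamma_1^1(E)=E$ when $m=1$). Then $\Gamma\text{-Cap}(E)=\sup_{U\in U(m,\mathbb C)}\mathrm{Cap}\,\Gamma_m^1(U(E))$, $U$ ranging over unitary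 transformations of $\mathbb C^m$. *)

theory Defs
  imports "HOL-Analysis.Analysis"
begin

text \<open>
  Formal power series over \<open>\<complex>\<close> whose variables are indexed by a finite type \<open>'n\<close>: multi-indices have type \<open>nat ^ 'n\<close>
  and points have type \<open>complex ^ 'n\<close>.
\<close>

typedef (overloaded) 'n mfps = "UNIV :: ((nat ^ 'n::finite) \<Rightarrow> complex) set"
  morphisms coeff_of Abs_mfps ..

setup_lifting type_definition_mfps

lemma mfps_eqI: "(\<And>p. coeff_of a p = coeff_of b p) \<Longrightarrow> a = b"
  by (metis coeff_of_inverse ext)

definition splits :: "nat ^ 'n::finite \<Rightarrow> ((nat ^ 'n) \<times> (nat ^ 'n)) set" where
  "splits p = {(q, r). q + r = p}"

lemma finite_splits: "finite (splits p)"
proof -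
  let ?B = "PiE UNIV (\<lambda>k. {..p $ k})"
  have fin: "finite (vec_lambda ` ?B)"
    by (intro finite_imageI finite_PiE) auto
  have "q \<in> vec_lambda ` ?B" if "\<And>k. q $ k \<le> p $ k" for q :: "nat ^ 'a"
    using that by (intro image_eqI[of _ _ "\<lambda>k. q $ k"]) (auto simp: PiE_def)
  then have "splits p \<subseteq> (vec_lambda ` ?B) \<times> (vec_lambda ` ?B)"
    by (auto simp: splits_def)
  then show ?thesis
    using fin by (meson finite_SigmaI finite_subset)
qed

instantiation mfps :: (finite) comm_ring_1
begin

lift_definition zero_mfps :: "'a mfps" is "\<lambda>p. 0" .
lift_definition one_mfps :: "'a mfps" is "\<lambda>p. if p = 0 then 1 else 0" .
lift_definition plus_mfps :: "'a mfps \<Rightarrow> 'a mfps \<Rightarrow> 'a mfps" is "\<lambda>a b p. a p + b p" .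
lift_definition minus_mfps :: "'a mfps \<Rightarrow> 'a mfps \<Rightarrow> 'a mfps" is "\<lambda>a b p. a p - b p" .
lift_definition uminus_mfps :: "'a mfps \<Rightarrow> 'a mfps" is "\<lambda>a p. - a p" .
lift_definition times_mfps :: "'a mfps \<Rightarrow> 'a mfps \<Rightarrow> 'a mfps" is
  "\<lambda>a b p. \<Sum>(q, r)\<in>splits p. a q * b r" .

instance
proof
  fix a b c :: "'a mfps"
  show "a + b + c = a + (b + c)" by transfer (simp add: add.assoc)
  show "a + b = b + a" by transfer (simp add: add.commute)
  show "0 + a = a" by transfer simp
  show "- a + a = 0" by transfer simp
  show "a - b = a + - b" by transfer simp
  show "(0::'a mfps) \<noteq> 1" by transfer (metis zero_neq_one)
  show "(a + b) * c = a * c + b * c"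
    by transfer (simp add: case_prod_unfold distrib_right sum.distrib)
  show "a * b = b * a"
  proof (transfer, rule ext)
    fix A B :: "nat ^ 'a \<Rightarrow> complex" and p
    show "(\<Sum>(q, r)\<in>splits p. A q * B r) = (\<Sum>(q, r)\<in>splits p. B q * A r)"
      by (rule sum.reindex_bij_witness[of _ prod.swap prod.swap])
        (auto simp: splits_def add.commute mult.commute)
  qed
  show "1 * a = a"
  proof (transfer, rule ext)
    fix A :: "nat ^ 'a \<Rightarrow> complex" and p
    have "(\<Sum>(q, r)\<in>splits p. (if q = 0 then 1 else 0) * A r)
        = (\<Sum>(q, r)\<in>{(0 :: nat ^ 'a, p)}. (if q = 0 then 1 else 0) * A r)"
      by (rule sum.mono_neutral_right[OF finite_splits]) (auto simp: splits_def split: if_splits)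
    then show "(\<Sum>(q, r)\<in>splits p. (if q = 0 then 1 else 0) * A r) = A p" by simp
  qed
  show "a * b * c = a * (b * c)"
  proof (transfer, rule ext)
    fix A B C :: "nat ^ 'a \<Rightarrow> complex" and p
    have "(\<Sum>(x, z)\<in>splits p. (\<Sum>(u, v)\<in>splits x. A u * B v) * C z)
        = (\<Sum>((x, z), (u, v))\<in>(SIGMA y:splits p. splits (fst y)). A u * B v * C z)"
      by (simp add: case_prod_unfold sum_distrib_right sum.Sigma finite_splits)
    also have "\<dots> = (\<Sum>((u, y), (v, z))\<in>(SIGMA y:splits p. splits (snd y)). A u * (B v * C z))"
      by (rule sum.reindex_bij_witness[of _
            "\<lambda>((u, y), (v, z)). ((u + v, z), (u, v))" "\<lambda>((x, z), (u, v)). ((u, v + z), (v, z))"])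
        (auto simp: splits_def add.assoc mult.assoc)
    also have "\<dots> = (\<Sum>(u, y)\<in>splits p. A u * (\<Sum>(v, z)\<in>splits y. B v * C z))"
      by (simp add: case_prod_unfold sum_distrib_left sum.Sigma finite_splits)
    finally show "(\<Sum>(x, z)\<in>splits p. (\<Sum>(u, v)\<in>splits x. A u * B v) * C z)
        = (\<Sum>(u, y)\<in>splits p. A u * (\<Sum>(v, z)\<in>splits y. B v * C z))" .
  qed
qed

end

definition mdeg :: "nat ^ 'n::finite \<Rightarrow> nat" where
  "mdeg p = (\<Sum>k\<in>UNIV. p $ k)"

definition mpower :: "complex ^ 'n::finite \<Rightarrow> nat ^ 'n \<Rightarrow> complex" where
  "mpower z p = (\<Prod>k\<in>UNIV. (z $ k) ^ (p $ k))"

lift_definition mfps_const :: "complex \<Rightarrow> 'n::finite mfps" is "\<lambda>c p. if p = 0 then c else 0" .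

lift_definition mfps_monom :: "nat ^ 'n::finite \<Rightarrow> 'n mfps" is "\<lambda>r p. if p = r then 1 else 0" .

definition mfps_var :: "'n::finite \<Rightarrow> 'n mfps" where
  "mfps_var k = mfps_monom (axis k 1)"

lift_definition mfps_deriv :: "'n::finite \<Rightarrow> 'n mfps \<Rightarrow> 'n mfps" is
  "\<lambda>k a p. of_nat (p $ k + 1) * a (p + axis k 1)" .

text \<open>
  Substitution \<open>g \<circ> h\<close>, meaningful only if every \<open>h k\<close> has zero constant term: then
  \<open>\<Prod>k. h k ^ p k\<close> has order at least \<open>mdeg p\<close>, so the terms with \<open>mdeg p > mdeg q\<close>, omitted
  below, do not contribute to the coefficient at \<open>q\<close>.
\<close>

definition mfps_subst :: "'n::finite mfps \<Rightarrow> ('n \<Rightarrow> 'n mfps) \<Rightarrow> 'n mfps" where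
  "mfps_subst g h = Abs_mfps (\<lambda>q. \<Sum>p | mdeg p \<le> mdeg q.
      coeff_of g p * coeff_of (\<Prod>k\<in>UNIV. h k ^ (p $ k)) q)"

text \<open>
  Germs at \<open>0\<close> of holomorphic functions are represented by their Taylor series, that is, by
  convergent series. Summability over the countable set of multi-indices is absolute convergence.
\<close>

definition mfps_converges :: "'n::finite mfps \<Rightarrow> bool" where
  "mfps_converges a \<longleftrightarrow>
     (\<forall>\<^sub>F z in nhds 0. (\<lambda>p. coeff_of a p * mpower z p) summable_on UNIV)"

definition mfps_eval :: "'n::finite mfps \<Rightarrow> complex ^ 'n \<Rightarrow> complex" where
  "mfps_eval a z = (\<Sum>\<^sub>\<infinity>p. coeff_of a p * mpower z p)"

definition map_converges :: "('n::finite \<Rightarrow> 'n mfps) \<Rightarrow> bool" where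
  "map_converges h \<longleftrightarrow> (\<forall>j. mfps_converges (h j))"

definition map_eval :: "('n::finite \<Rightarrow> 'n mfps) \<Rightarrow> complex ^ 'n \<Rightarrow> complex ^ 'n" where
  "map_eval h z = (\<chi> j. mfps_eval (h j) z)"

text \<open>
  Since the definition of \<open>\<Gamma>\<close>-capacity is by recursion on \<open>m\<close>, the space \<open>\<complex>\<^sup>m\<close> is rendered as the
  set of functions on \<open>{..<m}\<close> (extended by \<open>undefined\<close>). Coordinates are numbered from \<open>0\<close>.
\<close>

definition cspace :: "nat \<Rightarrow> (nat \<Rightarrow> complex) set" where
  "cspace m = ({..<m} \<rightarrow>\<^sub>E UNIV)"

definition multiindices :: "nat \<Rightarrow> (nat \<Rightarrow> nat) set" where
  "multiindices m = ({..<m} \<rightarrow>\<^sub>E UNIV)"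

definition ideg :: "nat \<Rightarrow> (nat \<Rightarrow> nat) \<Rightarrow> nat" where
  "ideg m i = (\<Sum>k<m. i k)"

definition ipower :: "nat \<Rightarrow> (nat \<Rightarrow> complex) \<Rightarrow> (nat \<Rightarrow> nat) \<Rightarrow> complex" where
  "ipower m t i = (\<Prod>k<m. t k ^ i k)"

definition polynomial_of_degree_le ::
  "nat \<Rightarrow> real \<Rightarrow> ((nat \<Rightarrow> complex) \<Rightarrow> complex) \<Rightarrow> bool" where
  "polynomial_of_degree_le m D \<phi> \<longleftrightarrow>
     (\<exists>c. \<forall>t\<in>cspace m.
        \<phi> t = (\<Sum>i | i \<in> multiindices m \<and> real (ideg m i) \<le> D. c i * ipower m t i))"

definition weight :: "nat ^ 'n::finite \<Rightarrow> complex ^ 'n \<Rightarrow> complex" where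
  "weight q lam = (\<Sum>k\<in>UNIV. of_nat (q $ k) * lam $ k)"

definition resonance :: "complex ^ 'n::finite \<Rightarrow> nat ^ 'n \<Rightarrow> 'n \<Rightarrow> bool" where
  "resonance lam q j \<longleftrightarrow> mdeg q \<ge> 2 \<and> weight q lam = lam $ j"

definition resonances_generated ::
  "complex ^ 'n::finite \<Rightarrow> nat \<Rightarrow> (nat \<Rightarrow> nat ^ 'n) \<Rightarrow> bool" where
  "resonances_generated lam l r \<longleftrightarrow>
     (\<forall>q j. resonance lam q j \<longrightarrow> (\<exists>k. q = axis j 1 + (\<Sum>s=1..l. k s *s r s)))"

definition vector_field ::
  "nat \<Rightarrow> nat \<Rightarrow> complex ^ 'n::finite \<Rightarrow> ('n \<Rightarrow> (nat \<Rightarrow> nat) \<Rightarrow> 'n mfps) \<Rightarrow>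
     (nat \<Rightarrow> complex) \<Rightarrow> 'n \<Rightarrow> 'n mfps" where
  "vector_field m d lam f t j =
     mfps_const (lam $ j) * mfps_var j
     + (\<Sum>i | i \<in> multiindices m \<and> 1 \<le> ideg m i \<and> ideg m i \<le> d.
          mfps_const (ipower m t i) * f j i)"

text \<open>
  The formal change of variables \<open>w = h z\<close> transforms \<open>dz/d\<tau> = X(z)\<close> into \<open>dw/d\<tau> = Y(w)\<close>.
\<close>

definition conjugates ::
  "('n::finite \<Rightarrow> 'n mfps) \<Rightarrow> ('n \<Rightarrow> 'n mfps) \<Rightarrow> ('n \<Rightarrow> 'n mfps) \<Rightarrow> bool" where
  "conjugates h X Y \<longleftrightarrow> (\<forall>j. (\<Sum>k\<in>UNIV. mfps_deriv k (h j) * X k) = mfps_subst (Y j) h)"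

definition tangent_to_identity :: "('n::finite \<Rightarrow> 'n mfps) \<Rightarrow> bool" where
  "tangent_to_identity h \<longleftrightarrow>
     (\<forall>j. coeff_of (h j) 0 = 0 \<and>
          (\<forall>k. coeff_of (h j) (axis k 1) = (if j = k then 1 else 0)))"

definition formal_normalization ::
  "complex ^ 'n::finite \<Rightarrow> nat \<Rightarrow> (nat \<Rightarrow> nat ^ 'n) \<Rightarrow> ('n \<Rightarrow> 'n mfps) \<Rightarrow> ('n \<Rightarrow> 'n mfps) \<Rightarrow> bool"
  where
  "formal_normalization lam l r X h \<longleftrightarrow>
     tangent_to_identity h \<and>
     (\<exists>g :: 'n \<Rightarrow> nat \<Rightarrow> 'n mfps.
        (\<forall>i. \<forall>s\<in>{1..l}. mdeg (r s) = 1 \<longrightarrow> coeff_of (g i s) 0 = 0) \<and>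
        conjugates h X
          (\<lambda>i. mfps_const (lam $ i) * mfps_var i + (\<Sum>s=1..l. g i s * mfps_monom (r s))))"

text \<open>
  Invariance of the germ at \<open>0\<close> of a set \<open>S\<close> under the flow, in complex time, of \<open>X\<close>. The
  condition on \<open>U\<close> passes to smaller neighbourhoods, so only germs at \<open>0\<close> matter.
\<close>

definition locally_invariant ::
  "(complex ^ 'n::finite \<Rightarrow> complex ^ 'n) \<Rightarrow> (complex ^ 'n) set \<Rightarrow> bool" where
  "locally_invariant X S \<longleftrightarrow>
     (\<exists>U. open U \<and> 0 \<in> U \<and>
        (\<forall>D \<gamma>. open D \<and> connected D \<and> \<gamma> ` D \<subseteq> U \<and>
           (\<forall>\<tau>\<in>D. \<forall>j. ((\<lambda>\<sigma>. \<gamma> \<sigma> $ j) has_field_derivative X (\<gamma> \<tau>) $ j) (at \<tau>)) \<and>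
           (\<exists>\<tau>\<in>D. \<gamma> \<tau> \<in> S) \<longrightarrow> \<gamma> ` D \<subseteq> S))"

text \<open>The case distinction is needed because \<open>ln 0 = 0\<close> in HOL.\<close>

definition log_kernel :: "complex \<Rightarrow> complex \<Rightarrow> ereal" where
  "log_kernel z w = (if z = w then -\<infinity> else ereal (ln (dist z w)))"

text \<open>
  The integral with values in \<open>[-\<infinity>, \<infinity>)\<close> as the difference of the integrals of the positive and
  negative parts; the former is finite for measures with compact support.
\<close>

definition log_energy :: "complex measure \<Rightarrow> ereal" where
  "log_energy \<mu> =
     enn2ereal (\<integral>\<^sup>+z. \<integral>\<^sup>+w. e2ennreal (log_kernel z w) \<partial>\<mu> \<partial>\<mu>)
     - enn2ereal (\<integral>\<^sup>+z. \<integral>\<^sup>+w. e2ennreal (- log_kernel z w) \<partial>\<mu> \<partial>\<mu>)"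

definition exp_ereal :: "ereal \<Rightarrow> ennreal" where
  "exp_ereal x = (case x of ereal y \<Rightarrow> ennreal (exp y) | PInfty \<Rightarrow> \<infinity> | MInfty \<Rightarrow> 0)"

definition compact_probs :: "complex set \<Rightarrow> complex measure set" where
  "compact_probs E = {\<mu>. sets \<mu> = sets borel \<and> emeasure \<mu> UNIV = 1 \<and>
     (\<exists>K. compact K \<and> K \<subseteq> E \<and> emeasure \<mu> (- K) = 0)}"

text \<open>The supremum of the empty set in \<^typ>\<open>ennreal\<close> is \<open>0\<close>, so \<open>log_capacity {} = 0\<close>.\<close>

definition log_capacity :: "complex set \<Rightarrow> ennreal" where
  "log_capacity E = (SUP \<mu>\<in>compact_probs E. exp_ereal (log_energy \<mu>))"

definition Gamma_step :: "nat \<Rightarrow> (nat \<Rightarrow> complex) set \<Rightarrow> (nat \<Rightarrow> complex) set" where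
  "Gamma_step m E = {z \<in> cspace (m - 1). log_capacity {w. z(m - 1 := w) \<in> E} > 0}"

fun Gamma_proj :: "nat \<Rightarrow> (nat \<Rightarrow> complex) set \<Rightarrow> complex set" where
  "Gamma_proj 0 E = {}"
| "Gamma_proj (Suc 0) E = (\<lambda>t. t 0) ` E"
| "Gamma_proj (Suc (Suc k)) E = Gamma_proj (Suc k) (Gamma_step (Suc (Suc k)) E)"

definition unitary_matrix :: "nat \<Rightarrow> (nat \<Rightarrow> nat \<Rightarrow> complex) \<Rightarrow> bool" where
  "unitary_matrix m U \<longleftrightarrow>
     (\<forall>i<m. \<forall>j<m. (\<Sum>k<m. cnj (U k i) * U k j) = (if i = j then 1 else 0))"

definition apply_matrix ::
  "nat \<Rightarrow> (nat \<Rightarrow> nat \<Rightarrow> complex) \<Rightarrow> (nat \<Rightarrow> complex) \<Rightarrow> (nat \<Rightarrow> complex)" where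
  "apply_matrix m U t = (\<lambda>i\<in>{..<m}. \<Sum>j<m. U i j * t j)"

definition Gamma_capacity :: "nat \<Rightarrow> (nat \<Rightarrow> complex) set \<Rightarrow> ennreal" where
  "Gamma_capacity m E =
     (SUP U\<in>{U. unitary_matrix m U}. log_capacity (Gamma_proj m (apply_matrix m U ` E)))"

end

theory Submission
  imports Defs "HOL-Complex_Analysis.Cauchy_Integral_Formula"
    "HOL-Computational_Algebra.Fundamental_Theorem_Algebra"
begin

text \<open>
  The coefficients of \<open>h t\<close> are polynomials in \<open>t\<close> whose degree grows at most linearly with the
  order, and \<open>h t\<close> converges iff its coefficients grow at most geometrically. If this happens on a set of
  positive capacity in \<open>\<complex>\<close>, it happens with uniform constants on a compact set carrying a measure
  with bounded logarithmic potential, and then a Bernstein--Walsh estimate extends the geometric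
  bound to the whole plane. Slicing along the coordinates gives the same for the
  \<open>\<Gamma>\<close>-capacity; the only property of the coefficients used is that they are polynomials of
  controlled degree on every complex line.

  As for invariance, put \<open>u s = w^(r s)\<close> with \<open>w = h t z\<close>. Along solutions, the derivatives of
  the \<open>u s\<close> are linear combinations of the \<open>u s\<close> with bounded coefficients, so if all \<open>u s\<close> vanish at
  one point, then they vanish identically. The coefficients \<open>g i s\<close> of the formal normal form may
  diverge, and convergent ones are obtained by dividing by the series \<open>w^(r s)\<close>.
\<close>

subsection \<open>Logarithmic capacity\<close>

text \<open>The Bernstein-Walsh estimate is proved without Green functions or equilibrium measures.
  Finite energy makes a potential finite only almost everywhere, so the carrier is covered, up to a
  null set, by countably many Borel sets with explicit bounds, one of which has positive measure. On
  a compact part \<open>K\<close> of it, averaging the kernels of the roots of a polynomial, moved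
  to \<open>K\<close>, yields one point of \<open>K\<close> where the polynomial is not much smaller
  than at the target, with a loss exponential in the degree. Growth constants are never compared
  between slices, so the passage to several variables asks for no uniformity.

  For the invariance, the obstacle is that the transformed nonlinear part is known to lie in the
  ideal of the series \<open>w^(r s)\<close> only formally. Tangency to the identity gives
  \<open>w^(r s)\<close> the leading monomial \<open>z^(r s)\<close>. Division with convergent
  quotients leaves a remainder without multiples of these monomials, whereas the lowest terms of any
  nonzero element of the closed formal ideal are such multiples. Hence the remainder is
  zero.\<close>

lemma one_add_div_le_exp:
  fixes x b :: real
  assumes "x > 0" "b \<ge> 1"
  shows "1 + b / x \<le> (1 + b) * exp (max 0 (- ln x))"
proof (cases "x \<ge> 1")
  case True
  then have "b / x \<le> b"
    using assms by (simp add: divide_le_eq mult_le_cancel_left1)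
  moreover have "max 0 (- ln x) = 0"
    using True by simp
  ultimately show ?thesis by simp
next
  case False
  then have "ln x < 0" using assms by simp
  then have "exp (max 0 (- ln x)) = 1 / x"
    using assms by (simp add: exp_minus inverse_eq_divide)
  then show ?thesis
    using assms False by (simp add: field_simps)
qed

lemma log_kernel_neg:
  "e2ennreal (- log_kernel z w) = (if z = w then \<infinity> else ennreal (max 0 (- ln (dist z w))))"
  by (simp add: log_kernel_def e2ennreal_ereal max_def ennreal_neg)

lemma measurable_log_kernel_neg [measurable]:
  "(\<lambda>w. e2ennreal (- log_kernel z w)) \<in> borel_measurable borel"
  "(\<lambda>(z, w). e2ennreal (- log_kernel z w)) \<in> borel_measurable (borel \<Otimes>\<^sub>M borel)"
  unfolding log_kernel_neg by measurable

text \<open>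
  A root \<open>a\<close> of the polynomial is compared with the point \<open>a'\<close> of \<open>K\<close> nearest to it: since
  \<open>dist z a' \<le> 2 * dist z a\<close> on \<open>K\<close>, a bound for the potential on \<open>K\<close> is a bound everywhere.
\<close>

lemma Bernstein_Walsh_root:
  fixes K :: "complex set"
  assumes "compact K" "K \<noteq> {}"
    and B: "B \<ge> 1" "\<And>z. z \<in> K \<Longrightarrow> dist t z \<le> B"
  obtains a' where "a' \<in> K"
    "\<And>z y. z \<in> K \<Longrightarrow> e2ennreal (- log_kernel a' z) \<le> ennreal y \<Longrightarrow> y \<ge> 0 \<Longrightarrow>
       dist t a \<le> dist z a * ((1 + 2 * B) * exp y)"
proof -
  obtain a' where a': "a' \<in> K" "\<And>z. z \<in> K \<Longrightarrow> dist a a' \<le> dist a z"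
    using distance_attains_inf[of K a] assms(1,2) compact_imp_closed by metis
  have "dist t a \<le> dist z a * ((1 + 2 * B) * exp y)"
    if z: "z \<in> K" and y: "e2ennreal (- log_kernel a' z) \<le> ennreal y" "y \<ge> 0" for z y
  proof -
    have ne: "a' \<noteq> z" and le: "max 0 (- ln (dist a' z)) \<le> y"
      using y by (auto simp: log_kernel_neg top_unique split: if_splits)
    have d: "dist a' z \<le> 2 * dist z a"
      using a'(2)[OF z] dist_triangle[of a' z a] by (simp add: dist_commute)
    then have pos: "dist z a > 0" "dist a' z > 0"
      using ne zero_less_dist_iff[of a' z] by linarith+
    have "dist t a \<le> dist z a + B"
      using dist_triangle[of t a z] B(2)[OF z] by simp
    also have "\<dots> = dist z a * (1 + B / dist z a)"
      using pos by (simp add: field_simps)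
    also have "\<dots> \<le> dist z a * (1 + 2 * B / dist a' z)"
      using pos d B(1) by (intro mult_left_mono add_left_mono) (simp_all add: field_simps)
    \<comment> \<open>Only the negative part of the kernel enters: at distances at least 1 the
      quotient is bounded by \<open>2 * B\<close>, and below 1 the reciprocal of the distance is the
      exponential of the kernel.\<close>
    also have "\<dots> \<le> dist z a * ((1 + 2 * B) * exp (max 0 (- ln (dist a' z))))"
      using pos B(1) by (intro mult_left_mono one_add_div_le_exp) auto
    also have "\<dots> \<le> dist z a * ((1 + 2 * B) * exp y)"
      using le B(1) by (intro mult_left_mono) auto
    finally show ?thesis .
  qed
  with a'(1) show ?thesis by (rule that)
qed

lemma poly_roots_list:
  fixes P :: "complex poly"
  assumes "P \<noteq> 0"
  obtains as where "length as = degree P" "\<And>x. poly P x = lead_coeff P * (\<Prod>a\<leftarrow>as. x - a)"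
proof -
  obtain A where A: "size A = degree P" "P = smult (lead_coeff P) (\<Prod>x\<in>#A. [:-x, 1:])"
    using alg_closed_imp_factorization[OF assms] by auto
  obtain as where as: "A = mset as"
    by (metis ex_mset)
  have "poly (\<Prod>x\<in>#mset as. [:-x, 1:]) x = (\<Prod>a\<leftarrow>as. x - a)" for x
    by (induction as) (auto simp: algebra_simps)
  then have "poly P x = lead_coeff P * (\<Prod>a\<leftarrow>as. x - a)" for x
    using A(2) as by (metis poly_smult)
  then show ?thesis
    using that[of as] A(1) as by simp
qed

text \<open>Averaging replaces the Green function. Each root is moved to \<open>K\<close>, where the
  potential is at most \<open>L\<close>; hence some \<open>z\<close> in \<open>K\<close> keeps the
  sum of the kernels below a fixed multiple of the degree, and at this \<open>z\<close> the factors
  \<open>dist z a\<close> control the factors \<open>dist t a\<close>. Mass of \<open>\<mu>\<close>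
  outside \<open>K\<close> is allowed, so that \<open>K\<close> can later be a small part of the
  carrier.\<close>

lemma Bernstein_Walsh_finite_potential:
  fixes \<mu> :: "complex measure"
  assumes sets: "sets \<mu> = sets borel" and fin: "finite_measure \<mu>"
    and K: "compact K" "emeasure \<mu> K > 0"
    and L: "\<And>z. z \<in> K \<Longrightarrow> (\<integral>\<^sup>+w. e2ennreal (- log_kernel z w) \<partial>\<mu>) \<le> ennreal L"
  shows "\<exists>C\<ge>0. \<forall>P M. (\<forall>z\<in>K. norm (poly P z) \<le> M) \<longrightarrow>
           norm (poly P t) \<le> M * exp (C * real (degree P))"
proof -
  interpret finite_measure \<mu> by fact
  note [measurable_cong] = sets
  define k where "k = measure \<mu> K"
  have kpos: "k > 0"
    using K(2) by (simp add: k_def emeasure_eq_measure)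
  have Kne: "K \<noteq> {}"
    using K(2) by auto
  have Ksets [measurable]: "K \<in> sets \<mu>"
    using K(1) sets by (simp add: borel_compact)
  obtain B0 where B0: "\<And>z. z \<in> K \<Longrightarrow> dist t z \<le> B0"
    using compact_imp_bounded[OF K(1)] bounded_any_center[of K t] by auto
  define B where "B = max 1 B0"
  have B: "B \<ge> 1" "\<And>z. z \<in> K \<Longrightarrow> dist t z \<le> B"
    using B0 by (auto simp: B_def intro: max.coboundedI2)
  define L' where "L' = max 0 L"
  have L': "\<And>z. z \<in> K \<Longrightarrow> (\<integral>\<^sup>+w. e2ennreal (- log_kernel z w) \<partial>\<mu>) \<le> ennreal L'"
    using L unfolding L'_def by (meson ennreal_leI max.cobounded2 order_trans)
  define a' where "a' a = (SOME b. b \<in> K \<and> (\<forall>z y. z \<in> K \<longrightarrow> e2ennreal (- log_kernel b z) \<le> ennreal y \<longrightarrow>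
      y \<ge> 0 \<longrightarrow> dist t a \<le> dist z a * ((1 + 2 * B) * exp y)))" for a
  have a': "a' a \<in> K" "\<And>z y. z \<in> K \<Longrightarrow> e2ennreal (- log_kernel (a' a) z) \<le> ennreal y \<Longrightarrow> y \<ge> 0 \<Longrightarrow>
       dist t a \<le> dist z a * ((1 + 2 * B) * exp y)" for a
  proof -
    have "\<exists>b. b \<in> K \<and> (\<forall>z y. z \<in> K \<longrightarrow> e2ennreal (- log_kernel b z) \<le> ennreal y \<longrightarrow>
      y \<ge> 0 \<longrightarrow> dist t a \<le> dist z a * ((1 + 2 * B) * exp y))"
      using Bernstein_Walsh_root[OF K(1) Kne B, of a] by metis
    from someI_ex[OF this] show "a' a \<in> K"
      "\<And>z y. z \<in> K \<Longrightarrow> e2ennreal (- log_kernel (a' a) z) \<le> ennreal y \<Longrightarrow> y \<ge> 0 \<Longrightarrow>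
       dist t a \<le> dist z a * ((1 + 2 * B) * exp y)"
      unfolding a'_def by blast+
  qed
  define G where "G z w = e2ennreal (- log_kernel z w)" for z w
  have [measurable]: "G z \<in> borel_measurable \<mu>" for z
    using measurable_log_kernel_neg(1)[of z] unfolding G_def by measurable
  \<comment> \<open>\<open>ln (1 + 2 * B)\<close> is the cost per root, \<open>(L' + 1) / k\<close>
    the share of one root in the kernel sum at the good point. The \<open>+ 1\<close> creates the
    gap that the averaging argument contradicts.\<close>
  define C where "C = ln (1 + 2 * B) + (L' + 1) / k"
  have "C \<ge> 0"
    using B(1) kpos by (auto simp: C_def L'_def)
  moreover have "norm (poly P t) \<le> M * exp (C * real (degree P))"
    if P: "\<forall>z\<in>K. norm (poly P z) \<le> M" for P M
  proof (cases "P = 0")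
    case True
    then show ?thesis using P Kne by auto
  next
    case False
    then obtain as where as: "length as = degree P"
      "\<And>x. poly P x = lead_coeff P * (\<Prod>a\<leftarrow>as. x - a)"
      using poly_roots_list by blast
    define D where "D = real (length as)"
    have int: "(\<integral>\<^sup>+w. (\<Sum>a\<leftarrow>as. G (a' a) w) \<partial>\<mu>) \<le> ennreal (D * L')"
    proof -
      have "(\<integral>\<^sup>+w. (\<Sum>a\<leftarrow>as. G (a' a) w) \<partial>\<mu>) \<le> ennreal (real (length as) * L') \<and>
            (\<lambda>w. (\<Sum>a\<leftarrow>as. G (a' a) w)) \<in> borel_measurable \<mu>"
      proof (induction as)
        case (Cons a as)
        then show ?case
          using L'[OF a'(1)[of a]]
          by (auto simp: nn_integral_add G_def[symmetric] distrib_right ennreal_plus L'_def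
              intro!: add_mono)
      qed auto
      then show ?thesis by (simp add: D_def)
    qed
    \<comment> \<open>Markov's inequality: a larger sum on all of \<open>K\<close> would integrate
      to at least \<open>D * (L' + 1)\<close>, above the bound \<open>D * L'\<close>.\<close>
    have "\<exists>z\<in>K. (\<Sum>a\<leftarrow>as. G (a' a) z) \<le> ennreal (D * ((L' + 1) / k))"
    proof (rule ccontr)
      assume "\<not> ?thesis"
      then have gt: "\<And>z. z \<in> K \<Longrightarrow> (\<Sum>a\<leftarrow>as. G (a' a) z) > ennreal (D * ((L' + 1) / k))"
        by (auto simp: not_le)
      then have "D \<noteq> 0" using Kne by (auto simp: D_def)
      then have Dpos: "D > 0" by (simp add: D_def)
      have "ennreal (D * (L' + 1)) = ennreal (D * ((L' + 1) / k)) * emeasure \<mu> K"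
        using kpos Dpos by (simp add: emeasure_eq_measure k_def[symmetric] L'_def flip: ennreal_mult)
      also have "\<dots> = (\<integral>\<^sup>+w. ennreal (D * ((L' + 1) / k)) * indicator K w \<partial>\<mu>)"
        by (simp add: nn_integral_cmult_indicator)
      also have "\<dots> \<le> (\<integral>\<^sup>+w. (\<Sum>a\<leftarrow>as. G (a' a) w) \<partial>\<mu>)"
        using gt by (intro nn_integral_mono) (auto simp: indicator_def less_imp_le)
      also note int
      finally have "D * (L' + 1) \<le> D * L'"
        using Dpos by (subst (asm) ennreal_le_iff) (auto simp: L'_def)
      with Dpos show False by (simp add: algebra_simps)
    qed
    then obtain z where z: "z \<in> K" "(\<Sum>a\<leftarrow>as. G (a' a) z) \<le> ennreal (D * ((L' + 1) / k))"
      by blast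
    \<comment> \<open>The budget \<open>y\<close> is split along the list: the first root spends
      \<open>y1\<close>, its own kernel value at \<open>z\<close>, the others share
      \<open>y - y1\<close>, and the exponentials multiply to \<open>exp y\<close>.\<close>
    have step: "(\<Prod>a\<leftarrow>as. dist t a) \<le> (\<Prod>a\<leftarrow>as. dist z a) * ((1 + 2 * B) ^ length as * exp y)"
      if "(\<Sum>a\<leftarrow>as. G (a' a) z) \<le> ennreal y" "y \<ge> 0" for as y
      using that
    proof (induction as arbitrary: y)
      case Nil
      then show ?case by simp
    next
      case (Cons a as)
      define y1 where "y1 = enn2real (G (a' a) z)"
      have le: "G (a' a) z + (\<Sum>a\<leftarrow>as. G (a' a) z) \<le> ennreal y"
        using Cons.prems by simp
      have le1: "G (a' a) z \<le> ennreal y"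
        using le by (rule order_trans[OF add_increasing2[OF zero_le order_refl]])
      then have "G (a' a) z < top"
        using ennreal_less_top by (rule le_less_trans)
      then have y1: "G (a' a) z = ennreal y1" "y1 \<ge> 0"
        by (auto simp: y1_def)
      have "ennreal y1 \<le> ennreal y"
        using le1 y1(1) by simp
      then have y1y: "y1 \<le> y"
        using Cons.prems(2) by simp
      have "(\<Sum>a\<leftarrow>as. G (a' a) z) \<le> ennreal (y - y1)"
      proof -
        have "ennreal y = ennreal y1 + ennreal (y - y1)"
          using y1y y1(2) by (simp flip: ennreal_plus)
        then show ?thesis
          using le y1(1) by (simp add: ennreal_add_left_cancel_le)
      qed
      then have IH: "(\<Prod>a\<leftarrow>as. dist t a) \<le>
          (\<Prod>a\<leftarrow>as. dist z a) * ((1 + 2 * B) ^ length as * exp (y - y1))"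
        using Cons.IH y1y by simp
      have nonneg: "(\<Prod>a\<leftarrow>as. dist x a) \<ge> 0" for x
        by (induction as) auto
      have "(\<Prod>a\<leftarrow>a # as. dist t a) = dist t a * (\<Prod>a\<leftarrow>as. dist t a)"
        by simp
      also have "\<dots> \<le> (dist z a * ((1 + 2 * B) * exp y1)) *
          ((\<Prod>a\<leftarrow>as. dist z a) * ((1 + 2 * B) ^ length as * exp (y - y1)))"
        using a'(2)[OF z(1), of a y1] y1 IH nonneg B(1)
        by (intro mult_mono) (auto simp: G_def)
      also have "\<dots> = (\<Prod>a\<leftarrow>a # as. dist z a) * ((1 + 2 * B) ^ length (a # as) * exp y)"
        by (simp add: exp_diff)
      finally show ?case .
    qed
    have norm_P: "norm (poly P x) = norm (lead_coeff P) * (\<Prod>a\<leftarrow>as. dist x a)" for x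
    proof -
      have "norm (\<Prod>a\<leftarrow>as. x - a) = (\<Prod>a\<leftarrow>as. dist x a)"
        by (induction as) (auto simp: norm_mult dist_norm)
      then show ?thesis using as(2)[of x] by (simp add: norm_mult)
    qed
    have y0: "D * ((L' + 1) / k) \<ge> 0"
      using kpos by (auto simp: D_def L'_def)
    have "norm (poly P t) \<le> norm (lead_coeff P) *
        ((\<Prod>a\<leftarrow>as. dist z a) * ((1 + 2 * B) ^ length as * exp (D * ((L' + 1) / k))))"
      unfolding norm_P using step[OF z(2) y0] by (intro mult_left_mono) auto
    also have "\<dots> = norm (poly P z) * ((1 + 2 * B) ^ length as * exp (D * ((L' + 1) / k)))"
      unfolding norm_P by simp
    also have "(1 + 2 * B) ^ length as * exp (D * ((L' + 1) / k)) = exp (C * D)"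
    proof -
      have "(1 + 2 * B) ^ length as = exp (D * ln (1 + 2 * B))"
        using B(1) by (simp add: D_def exp_of_nat_mult)
      then show ?thesis
        by (simp add: C_def algebra_simps flip: exp_add)
    qed
    also have "norm (poly P z) * exp (C * D) \<le> M * exp (C * D)"
      using P z(1) by (intro mult_right_mono) auto
    finally show ?thesis
      using as(1) by (simp add: D_def)
  qed
  ultimately show ?thesis by blast
qed

text \<open>The exponent \<open>w i + 1\<close> lets the base absorb constant factors even at weight
  \<open>0\<close>. The base is a natural number so that the possible bounds form a countable
  family, as the measure argument requires.\<close>

definition exp_bounded :: "('i \<Rightarrow> nat) \<Rightarrow> ('i \<Rightarrow> complex) \<Rightarrow> bool" where
  "exp_bounded w x \<longleftrightarrow> (\<exists>N::nat. \<forall>i. norm (x i) \<le> real N ^ (w i + 1))"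

lemma exp_boundedI:
  assumes "\<And>i. norm (x i) \<le> R ^ (w i + 1)" "R \<ge> 0"
  shows "exp_bounded w x"
proof -
  have "norm (x i) \<le> real (nat \<lceil>R\<rceil>) ^ (w i + 1)" for i
    using assms(1)[of i] by (rule order_trans) (intro power_mono real_nat_ceiling_ge assms(2))
  then show ?thesis
    unfolding exp_bounded_def by blast
qed

text \<open>Positive capacity excludes the energy \<open>-\<infinity>\<close>. This makes the
  negative part finite only once the positive part is known to be finite, since
  \<open>\<infinity> - \<infinity>\<close> is \<open>\<infinity>\<close> in \<open>ereal\<close>;
  boundedness of \<open>K\<close> supplies that.\<close>

lemma compact_probs_of_log_capacity_pos:
  assumes "log_capacity E > 0"
  obtains \<mu> K where "sets \<mu> = sets borel" "emeasure \<mu> UNIV = 1" "compact K" "K \<subseteq> E"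
    "emeasure \<mu> (- K) = 0"
    "(\<integral>\<^sup>+z. \<integral>\<^sup>+w. e2ennreal (- log_kernel z w) \<partial>\<mu> \<partial>\<mu>) < top"
proof -
  obtain \<mu> where \<mu>: "\<mu> \<in> compact_probs E" "exp_ereal (log_energy \<mu>) > 0"
    using assms by (auto simp: log_capacity_def less_SUP_iff)
  then obtain K where K: "sets \<mu> = sets borel" "emeasure \<mu> UNIV = 1" "compact K" "K \<subseteq> E"
    "emeasure \<mu> (- K) = 0"
    by (auto simp: compact_probs_def)
  note [measurable_cong] = K(1)
  have space: "space \<mu> = UNIV"
    using sets_eq_imp_space_eq[OF K(1)] by simp
  have [measurable]: "K \<in> sets \<mu>"
    using K by (simp add: borel_compact)
  have AE: "AE z in \<mu>. z \<in> K"
    by (rule AE_I[of _ _ "- K"]) (use K space in \<open>auto simp: borel_comp borel_compact\<close>)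
  obtain b where b: "\<And>x y. x \<in> K \<Longrightarrow> y \<in> K \<Longrightarrow> dist x y \<le> b"
    using compact_imp_bounded[OF K(3)] bounded_two_points by metis
  have pos_part: "e2ennreal (log_kernel z w) \<le> ennreal (ln (max 1 b))" if "z \<in> K" "w \<in> K" for z w
  proof (cases "z = w")
    case False
    then have "ln (dist z w) \<le> ln (max 1 b)"
      using b[OF that] by (subst ln_le_cancel_iff) auto
    then show ?thesis
      using False by (simp add: log_kernel_def e2ennreal_ereal ennreal_leI)
  qed (simp add: log_kernel_def e2ennreal_neg)
  have "(\<integral>\<^sup>+z. \<integral>\<^sup>+w. e2ennreal (log_kernel z w) \<partial>\<mu> \<partial>\<mu>) \<le> (\<integral>\<^sup>+z. \<integral>\<^sup>+w. ennreal (ln (max 1 b)) \<partial>\<mu> \<partial>\<mu>)"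
  proof (intro nn_integral_mono_AE)
    show "AE z in \<mu>. (\<integral>\<^sup>+w. e2ennreal (log_kernel z w) \<partial>\<mu>) \<le> (\<integral>\<^sup>+w. ennreal (ln (max 1 b)) \<partial>\<mu>)"
      using AE
    proof eventually_elim
      case (elim z)
      show ?case
        using AE by (intro nn_integral_mono_AE) (auto elim!: eventually_mono intro: pos_part elim)
    qed
  qed
  also have "\<dots> < top"
    using K(2) space by simp
  finally have "(\<integral>\<^sup>+z. \<integral>\<^sup>+w. e2ennreal (log_kernel z w) \<partial>\<mu> \<partial>\<mu>) < top" .
  then obtain p where p: "enn2ereal (\<integral>\<^sup>+z. \<integral>\<^sup>+w. e2ennreal (log_kernel z w) \<partial>\<mu> \<partial>\<mu>) = ereal p"
    by (cases "\<integral>\<^sup>+z. \<integral>\<^sup>+w. e2ennreal (log_kernel z w) \<partial>\<mu> \<partial>\<mu>") auto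
  have "log_energy \<mu> \<noteq> - \<infinity>"
    using \<mu>(2) by (auto simp: exp_ereal_def)
  then have "(\<integral>\<^sup>+z. \<integral>\<^sup>+w. e2ennreal (- log_kernel z w) \<partial>\<mu> \<partial>\<mu>) \<noteq> top"
    using p by (auto simp: log_energy_def)
  then show ?thesis
    using that K by (simp add: less_top)
qed

text \<open>Pointwise bounds become uniform by countable subadditivity: almost every point of
  \<open>K\<close> lies in some \<open>A N\<close>, where \<open>N\<close> bounds both the family
  and the potential, so one \<open>A N\<close> has positive measure. \<open>E\<close> may be
  non-measurable, because the capacity supplies a compact \<open>K\<close> inside it.\<close>

theorem Bernstein_Walsh_log_capacity:
  fixes P :: "'i \<Rightarrow> complex poly"
  assumes E: "log_capacity E > 0" "\<And>s. s \<in> E \<Longrightarrow> exp_bounded w (\<lambda>i. poly (P i) s)"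
    and deg: "\<And>i. real (degree (P i)) \<le> C0 + C1 * real (w i)" and C: "C0 > 0" "C1 > 0"
  shows "exp_bounded w (\<lambda>i. poly (P i) t)"
proof -
  obtain \<mu> K where K: "sets \<mu> = sets borel" "emeasure \<mu> UNIV = 1" "compact K" "K \<subseteq> E"
    "emeasure \<mu> (- K) = 0"
    and energy: "(\<integral>\<^sup>+z. \<integral>\<^sup>+w. e2ennreal (- log_kernel z w) \<partial>\<mu> \<partial>\<mu>) < top"
    using compact_probs_of_log_capacity_pos[OF E(1)] by blast
  note [measurable_cong] = K(1)
  have space: "space \<mu> = UNIV"
    using sets_eq_imp_space_eq[OF K(1)] by simp
  interpret finite_measure \<mu>
    by standard (simp add: space K(2))
  have [measurable]: "K \<in> sets \<mu>"
    using K by (simp add: borel_compact)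
  have AEK: "AE z in \<mu>. z \<in> K"
    by (rule AE_I[of _ _ "- K"]) (use K space in \<open>auto simp: borel_comp borel_compact\<close>)
  define L where "L z = (\<integral>\<^sup>+w. e2ennreal (- log_kernel z w) \<partial>\<mu>)" for z
  have L_measurable [measurable]: "L \<in> borel_measurable \<mu>"
    using measurable_log_kernel_neg(2) unfolding L_def by measurable
  have AEL: "AE z in \<mu>. L z \<noteq> top"
    using energy nn_integral_noteq_infinite[of L \<mu>] unfolding L_def[symmetric] by simp
  define S where "S N = {z. \<forall>i. norm (poly (P i) z) \<le> real N ^ (w i + 1)}" for N :: nat
  define A where "A N = K \<inter> S N \<inter> {z. L z \<le> ennreal (real N)}" for N :: nat
  \<comment> \<open>The index type may be uncountable, so measurability of \<open>S N\<close> is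
    derived from its being an intersection of closed sets.\<close>
  have "closed (S N)" for N
  proof -
    have "S N = (\<Inter>i. {z. norm (poly (P i) z) \<le> real N ^ (w i + 1)})"
      by (auto simp: S_def)
    moreover have "closed {z. norm (poly (P i) z) \<le> real N ^ (w i + 1)}" for i
      by (intro closed_Collect_le continuous_intros)
    ultimately show ?thesis by auto
  qed
  then have S_sets [measurable]: "S N \<in> sets \<mu>" for N
    using K(1) by simp
  have "{z \<in> space \<mu>. L z \<le> ennreal (real N)} \<in> sets \<mu>" for N
    by measurable
  then have A_sets [measurable]: "A N \<in> sets \<mu>" for N
    unfolding A_def by (auto simp: space)
  have cover: "z \<in> (\<Union>N. A N)" if z: "z \<in> K" "L z \<noteq> top" for z
  proof -
    obtain N1 where N1: "\<And>i. norm (poly (P i) z) \<le> real N1 ^ (w i + 1)"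
      using E(2)[of z] z K(4) unfolding exp_bounded_def by auto
    obtain r where r: "L z = ennreal r"
      using z(2) by (cases "L z") auto
    obtain N2 :: nat where "r \<le> real N2"
      using real_arch_simple by blast
    then have N2: "L z \<le> ennreal (real N2)"
      using r by (simp add: ennreal_leI)
    have "norm (poly (P i) z) \<le> real (max N1 N2) ^ (w i + 1)" for i
      using N1[of i] by (rule order_trans) (intro power_mono, auto)
    moreover have "L z \<le> ennreal (real (max N1 N2))"
      using N2 by (rule order_trans) (intro ennreal_leI, auto)
    ultimately have "z \<in> A (max N1 N2)"
      using z by (simp add: A_def S_def)
    then show ?thesis by blast
  qed
  have "\<exists>N. emeasure \<mu> (A N) \<noteq> 0"
  proof (rule ccontr)
    assume "\<not> ?thesis"
    then have "emeasure \<mu> (\<Union>N. A N) = 0"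
      by (intro emeasure_UN_eq_0) auto
    moreover have "AE z in \<mu>. z \<in> (\<Union>N. A N)"
      using AEK AEL by eventually_elim (rule cover)
    then have "emeasure \<mu> (\<Union>N. A N) = emeasure \<mu> (space \<mu>)"
      by (intro emeasure_eq_AE) auto
    ultimately show False
      using K(2) space by simp
  qed
  then obtain N where N: "emeasure \<mu> (A N) > 0"
    by (auto simp: zero_less_iff_neq_zero)
  \<comment> \<open>\<open>A N\<close> is only known to be Borel; inner regularity shrinks it to a
    compact set that still has positive measure.\<close>
  have "emeasure \<mu> (A N) = (SUP K\<in>{K. K \<subseteq> A N \<and> compact K}. emeasure \<mu> K)"
    by (rule inner_regular) (use K space in auto)
  then obtain K' where K': "K' \<subseteq> A N" "compact K'" "emeasure \<mu> K' > 0"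
    using N by (auto simp: less_SUP_iff)
  \<comment> \<open>The potential is that of the whole measure \<open>\<mu>\<close>, not of its
    restriction to \<open>K'\<close>; the bound by \<open>N\<close> is part of the definition of
    \<open>A N\<close>.\<close>
  have "\<exists>C\<ge>0. \<forall>P M. (\<forall>z\<in>K'. norm (poly P z) \<le> M) \<longrightarrow>
           norm (poly P t) \<le> M * exp (C * real (degree P))"
    by (rule Bernstein_Walsh_finite_potential[of \<mu> K' "real N"])
      (use K' K finite_measure_axioms in \<open>auto simp: A_def L_def\<close>)
  then obtain B where B: "B \<ge> 0" "\<And>P M. (\<forall>z\<in>K'. norm (poly P z) \<le> M) \<Longrightarrow>
           norm (poly P t) \<le> M * exp (B * real (degree P))"
    by blast
  \<comment> \<open>The degree is at most \<open>(C0 + C1) * (w i + 1)\<close>, so the loss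
    exponential in the degree is absorbed into the base.\<close>
  have "norm (poly (P i) t) \<le> (real N * exp (B * (C0 + C1))) ^ (w i + 1)" for i
  proof -
    have "norm (poly (P i) t) \<le> real N ^ (w i + 1) * exp (B * real (degree (P i)))"
      using K'(1) by (intro B(2)) (auto simp: A_def S_def)
    also have "\<dots> \<le> real N ^ (w i + 1) * exp (B * ((C0 + C1) * real (w i + 1)))"
    proof -
      have nonneg: "0 \<le> C0 * real (w i)"
        using C(1) by simp
      have expand: "(C0 + C1) * real (w i + 1) = C0 * real (w i) + C1 * real (w i) + C0 + C1"
        by (simp add: algebra_simps)
      have "real (degree (P i)) \<le> (C0 + C1) * real (w i + 1)"
        unfolding expand using deg[of i] C nonneg by linarith
      then show ?thesis
        using B(1) by (intro mult_left_mono) (auto intro!: mult_left_mono)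
    qed
    also have "\<dots> = (real N * exp (B * (C0 + C1))) ^ (w i + 1)"
      by (simp only: power_mult_distrib flip: exp_of_nat_mult) (simp add: mult_ac)
    finally show ?thesis .
  qed
  then show ?thesis
    by (rule exp_boundedI) simp
qed

section \<open>Polynomials on complex lines, slices and unitary changes of coordinates\<close>

definition line_polynomial :: "nat \<Rightarrow> real \<Rightarrow> ((nat \<Rightarrow> complex) \<Rightarrow> complex) \<Rightarrow> bool" where
  "line_polynomial m D \<phi> \<longleftrightarrow> (\<forall>a b. \<exists>p. real (degree p) \<le> D \<and>
     (\<forall>s. \<phi> (\<lambda>k\<in>{..<m}. a k + s * b k) = poly p s))"

lemma finite_multiindices_le: "finite {i \<in> multiindices m. real (ideg m i) \<le> D}"
proof (rule finite_subset)
  show "{i \<in> multiindices m. real (ideg m i) \<le> D} \<subseteq> PiE {..<m} (\<lambda>_. {..nat \<lfloor>D\<rfloor>})"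
  proof (intro subsetI)
    fix i assume i: "i \<in> {i \<in> multiindices m. real (ideg m i) \<le> D}"
    have "i k \<le> nat \<lfloor>D\<rfloor>" if "k < m" for k
    proof -
      have "i k \<le> ideg m i"
        unfolding ideg_def using that by (intro member_le_sum) auto
      then show ?thesis
        using i by (simp add: le_nat_floor)
    qed
    then show "i \<in> PiE {..<m} (\<lambda>_. {..nat \<lfloor>D\<rfloor>})"
      using i by (auto simp: multiindices_def)
  qed
qed (auto intro: finite_PiE)

lemma line_polynomial_of_polynomial:
  assumes "polynomial_of_degree_le m D \<phi>" "D \<ge> 0"
  shows "line_polynomial m D \<phi>"
  unfolding line_polynomial_def
proof (intro allI)
  fix a b :: "nat \<Rightarrow> complex"
  let ?I = "{i \<in> multiindices m. real (ideg m i) \<le> D}"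
  obtain c where c: "\<And>t. t \<in> cspace m \<Longrightarrow> \<phi> t = (\<Sum>i\<in>?I. c i * ipower m t i)"
    using assms(1) unfolding polynomial_of_degree_le_def by blast
  define q where "q i = (\<Prod>k<m. [:a k, b k:] ^ i k)" for i
  define p where "p = (\<Sum>i\<in>?I. smult (c i) (q i))"
  have "degree (q i) \<le> ideg m i" for i
  proof -
    have "degree (q i) \<le> (\<Sum>k<m. degree ([:a k, b k:] ^ i k))"
      unfolding q_def by (rule degree_prod_sum_le[unfolded comp_def]) simp
    also have "\<dots> \<le> (\<Sum>k<m. i k)"
    proof (rule sum_mono)
      fix k
      have "degree ([:a k, b k:] ^ i k) \<le> degree [:a k, b k:] * i k"
        by (rule degree_power_le)
      also have "\<dots> \<le> 1 * i k"
        by (rule mult_right_mono) auto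
      finally show "degree ([:a k, b k:] ^ i k) \<le> i k" by simp
    qed
    finally show ?thesis by (simp add: ideg_def)
  qed
  then have "degree p \<le> nat \<lfloor>D\<rfloor>"
    unfolding p_def
    by (intro degree_sum_le finite_multiindices_le order_trans[OF degree_smult_le])
      (force simp: le_nat_floor intro: order_trans)
  \<comment> \<open>For negative \<open>D\<close> even the zero polynomial, of degree
    \<open>0\<close>, would violate the bound; hence the hypothesis on \<open>D\<close>.\<close>
  then have "real (degree p) \<le> D"
    using assms(2) by linarith
  moreover have "\<phi> (\<lambda>k\<in>{..<m}. a k + s * b k) = poly p s" for s
    by (subst c) (auto simp: cspace_def p_def q_def poly_sum poly_prod ipower_def intro!: sum.cong prod.cong)
  ultimately show "\<exists>p. real (degree p) \<le> D \<and> (\<forall>s. \<phi> (\<lambda>k\<in>{..<m}. a k + s * b k) = poly p s)"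
    by blast
qed

lemma cspace_restrict: "t \<in> cspace m \<Longrightarrow> (\<lambda>k\<in>{..<m}. t k) = t"
  by (auto simp: cspace_def PiE_def extensional_restrict)

text \<open>Induction along the recursion of \<open>Gamma_proj\<close>. Over a point of
  \<open>Gamma_step\<close> the one-variable theorem covers the whole fibre in the last coordinate;
  then, for each fixed last coordinate, the induction hypothesis applies to the restricted family.
  Constants may vary from fibre to fibre, as only \<open>exp_bounded\<close> at single points is
  passed on. Both restrictions inherit polynomiality on lines.\<close>

lemma exp_bounded_of_Gamma_proj:
  fixes \<Phi> :: "'i \<Rightarrow> (nat \<Rightarrow> complex) \<Rightarrow> complex"
  assumes "\<And>i. line_polynomial m (C0 + C1 * real (w i)) (\<Phi> i)" "C0 > 0" "C1 > 0"
    and "E \<subseteq> cspace m" "\<And>t. t \<in> E \<Longrightarrow> exp_bounded w (\<lambda>i. \<Phi> i t)"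
    and "log_capacity (Gamma_proj m E) > 0"
    and "t \<in> cspace m"
  shows "exp_bounded w (\<lambda>i. \<Phi> i t)"
  using assms
proof (induction m E arbitrary: \<Phi> t rule: Gamma_proj.induct)
  case (1 E)
  have "compact_probs {} = {}"
    by (auto simp: compact_probs_def)
  then have "log_capacity {} = 0"
    by (simp add: log_capacity_def bot_ennreal)
  with 1 show ?case by simp
next
  case (2 E)
  have "\<exists>p. real (degree p) \<le> C0 + C1 * real (w i) \<and> (\<forall>s. \<Phi> i (\<lambda>k\<in>{..<1}. s) = poly p s)" for i
    using 2(1)[of i, unfolded line_polynomial_def, rule_format, of "\<lambda>_. 0" "\<lambda>_. 1"] by simp
  then obtain p where p: "\<And>i. real (degree (p i)) \<le> C0 + C1 * real (w i)"
    "\<And>i s. \<Phi> i (\<lambda>k\<in>{..<1}. s) = poly (p i) s"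
    by metis
  have one: "(\<lambda>k\<in>{..<1}. t 0) = t" if "t \<in> cspace (Suc 0)" for t :: "nat \<Rightarrow> complex"
  proof
    fix j
    show "(\<lambda>k\<in>{..<1}. t 0) j = t j"
      using fun_cong[OF cspace_restrict[OF that], of j] by (cases "j = 0") simp_all
  qed
  have "exp_bounded w (\<lambda>i. poly (p i) (t 0))"
  proof (rule Bernstein_Walsh_log_capacity[OF _ _ p(1) 2(2,3)])
    show "log_capacity ((\<lambda>t. t 0) ` E) > 0"
      using 2(6) by simp
    fix s assume "s \<in> (\<lambda>t. t 0) ` E"
    then obtain u where "u \<in> E" "s = u 0" by blast
    then show "exp_bounded w (\<lambda>i. poly (p i) s)"
      using 2(4) 2(5)[of u] one[of u] by (auto simp flip: p(2))
  qed
  then show ?case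
    using one[OF 2(7)] by (simp flip: p(2))
next
  case (3 k E)
  let ?m = "Suc k"
  \<comment> \<open>Appending the last coordinate \<open>x + s * y\<close> to a line gives a line.
    With zero direction before it and \<open>y = 1\<close> this is a fibre; with
    \<open>y = 0\<close> it lies in the hyperplane where the last coordinate is
    \<open>x\<close>.\<close>
  have upd: "(\<lambda>j\<in>{..<?m}. a j + s * b j)(?m := x + s * y) =
      (\<lambda>j\<in>{..<Suc ?m}. (a(?m := x)) j + s * (b(?m := y)) j)" for a b :: "nat \<Rightarrow> complex" and s x y
    by (auto simp: restrict_def fun_eq_iff)
  have slice: "exp_bounded w (\<lambda>i. \<Phi> i (z(?m := x)))" if z: "z \<in> Gamma_step (Suc ?m) E" for z x
  proof -
    have zc: "z \<in> cspace ?m" and cap: "log_capacity {x. z(?m := x) \<in> E} > 0"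
      using z by (auto simp: Gamma_step_def)
    have line: "z(?m := s) = (\<lambda>j\<in>{..<Suc ?m}. (z(?m := 0)) j + s * ((\<lambda>_. 0)(?m := 1)) j)" for s
      using upd[of z s "\<lambda>_. 0" 0 1] cspace_restrict[OF zc] by simp
    have "\<exists>p. real (degree p) \<le> C0 + C1 * real (w i) \<and> (\<forall>s. \<Phi> i (z(?m := s)) = poly p s)" for i
    proof -
      obtain p where p: "real (degree p) \<le> C0 + C1 * real (w i)"
        "\<And>s. \<Phi> i (\<lambda>j\<in>{..<Suc ?m}. (z(?m := 0)) j + s * ((\<lambda>_. 0)(?m := 1)) j) = poly p s"
        using 3(2)[of i] unfolding line_polynomial_def by blast
      have "\<Phi> i (z(?m := s)) = poly p s" for s
        using p(2) by (subst line)
      with p(1) show ?thesis by blast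
    qed
    then obtain p where p: "\<And>i. real (degree (p i)) \<le> C0 + C1 * real (w i)"
      "\<And>i s. \<Phi> i (z(?m := s)) = poly (p i) s"
      by metis
    have "exp_bounded w (\<lambda>i. poly (p i) x)"
      by (rule Bernstein_Walsh_log_capacity[OF cap _ p(1) 3(3,4)]) (use 3(6) in \<open>auto simp flip: p(2)\<close>)
    then show ?thesis
      by (simp flip: p(2))
  qed
  \<comment> \<open>Now \<open>x\<close> is frozen, and the set of positive capacity is
    \<open>Gamma_step (Suc ?m) E\<close>, on which \<open>slice\<close> gives the bounds at this
    \<open>x\<close>.\<close>
  have hyper: "exp_bounded w (\<lambda>i. \<Phi> i (z(?m := x)))" if "z \<in> cspace ?m" for z x
  proof (rule 3(1)[of "\<lambda>i z. \<Phi> i (z(?m := x))"])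
    show "line_polynomial ?m (C0 + C1 * real (w i)) (\<lambda>z. \<Phi> i (z(?m := x)))" for i
      unfolding line_polynomial_def
    proof (intro allI)
      fix a b :: "nat \<Rightarrow> complex"
      show "\<exists>p. real (degree p) \<le> C0 + C1 * real (w i) \<and>
          (\<forall>s. \<Phi> i ((\<lambda>j\<in>{..<?m}. a j + s * b j)(?m := x)) = poly p s)"
        using 3(2)[of i] upd[of a _ b x 0] unfolding line_polynomial_def by simp
    qed
    show "Gamma_step (Suc ?m) E \<subseteq> cspace ?m"
      by (auto simp: Gamma_step_def)
    show "log_capacity (Gamma_proj ?m (Gamma_step (Suc ?m) E)) > 0"
      using 3(7) by simp
  qed (use 3(3,4) that slice in auto)
  define z where "z = (\<lambda>j\<in>{..<?m}. t j)"
  have "z(?m := t ?m) = t"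
    using cspace_restrict[OF 3(8)] by (auto simp: z_def restrict_def fun_eq_iff less_Suc_eq split: if_splits)
  moreover have "z \<in> cspace ?m"
    by (auto simp: z_def cspace_def)
  ultimately show ?case
    using hyper[of z "t ?m"] by simp
qed

lemma apply_matrix_cspace: "apply_matrix m U t \<in> cspace m"
  by (auto simp: apply_matrix_def cspace_def)

text \<open>\<open>unitary_matrix\<close> says that the columns are orthonormal, which is exactly
  that the conjugate transpose is a left inverse.\<close>

lemma unitary_matrix_left_inverse:
  assumes "unitary_matrix m U" "t \<in> cspace m"
  shows "apply_matrix m (\<lambda>i j. cnj (U j i)) (apply_matrix m U t) = t"
proof -
  have "(\<Sum>j<m. cnj (U j i) * (\<Sum>k<m. U j k * t k)) = t i" if "i < m" for i
  proof -
    have "(\<Sum>j<m. cnj (U j i) * (\<Sum>k<m. U j k * t k)) = (\<Sum>k<m. \<Sum>j<m. cnj (U j i) * U j k * t k)"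
      by (subst sum.swap) (simp add: sum_distrib_left mult.assoc)
    also have "\<dots> = (\<Sum>k<m. (if i = k then 1 else 0) * t k)"
      using assms(1) that by (intro sum.cong) (simp_all add: unitary_matrix_def flip: sum_distrib_right)
    also have "\<dots> = t i"
      using that by (simp add: if_distrib[of "\<lambda>x. x * _"] cong: if_cong)
    finally show ?thesis .
  qed
  then have "apply_matrix m (\<lambda>i j. cnj (U j i)) (apply_matrix m U t) = (\<lambda>k\<in>{..<m}. t k)"
    by (auto simp: apply_matrix_def)
  then show ?thesis
    using cspace_restrict[OF assms(2)] by simp
qed

text \<open>The unitary map is moved from the set to the family: each \<open>\<Phi> i\<close> is
  composed with the inverse map and studied on the image of \<open>E\<close>. Linear maps send lines
  to lines, so the degree bounds on lines survive.\<close>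

theorem exp_bounded_of_Gamma_capacity:
  fixes \<Phi> :: "'i \<Rightarrow> (nat \<Rightarrow> complex) \<Rightarrow> complex"
  assumes poly: "\<And>i. polynomial_of_degree_le m (C0 + C1 * real (w i)) (\<Phi> i)" and C: "C0 > 0" "C1 > 0"
    and E: "E \<subseteq> cspace m" "\<And>t. t \<in> E \<Longrightarrow> exp_bounded w (\<lambda>i. \<Phi> i t)" "Gamma_capacity m E \<noteq> 0"
    and t: "t \<in> cspace m"
  shows "exp_bounded w (\<lambda>i. \<Phi> i t)"
proof -
  obtain U where U: "unitary_matrix m U" "log_capacity (Gamma_proj m (apply_matrix m U ` E)) > 0"
    using E(3) unfolding Gamma_capacity_def zero_less_iff_neq_zero[symmetric] less_SUP_iff by auto
  define V where "V i j = cnj (U j i)" for i j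
  have VU: "apply_matrix m V (apply_matrix m U t) = t" if "t \<in> cspace m" for t
    using unitary_matrix_left_inverse[OF U(1) that] by (simp add: V_def[abs_def])
  have "exp_bounded w (\<lambda>i. \<Phi> i (apply_matrix m V (apply_matrix m U t)))"
  proof (rule exp_bounded_of_Gamma_proj[where \<Phi> = "\<lambda>i t. \<Phi> i (apply_matrix m V t)", OF _ C])
    fix i
    have lp: "line_polynomial m (C0 + C1 * real (w i)) (\<Phi> i)"
      using poly C by (intro line_polynomial_of_polynomial) auto
    have "apply_matrix m V (\<lambda>k\<in>{..<m}. a k + s * b k) =
        (\<lambda>k\<in>{..<m}. apply_matrix m V a k + s * apply_matrix m V b k)" for a b s
      by (auto simp: apply_matrix_def fun_eq_iff distrib_left sum.distrib sum_distrib_left mult_ac)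
    then show "line_polynomial m (C0 + C1 * real (w i)) (\<lambda>t. \<Phi> i (apply_matrix m V t))"
      using lp unfolding line_polynomial_def by simp
  qed (use E U VU apply_matrix_cspace in auto)
  then show ?thesis
    using VU[OF t] by simp
qed

subsection \<open>Formal power series\<close>

lemmas coeff_simps = zero_mfps.rep_eq one_mfps.rep_eq plus_mfps.rep_eq minus_mfps.rep_eq
  uminus_mfps.rep_eq mfps_const.rep_eq mfps_monom.rep_eq

lemma coeff_sum: "coeff_of (\<Sum>i\<in>A. f i) p = (\<Sum>i\<in>A. coeff_of (f i) p)"
  by (induction A rule: infinite_finite_induct) (auto simp: coeff_simps)

lemma coeff_Abs [simp]: "coeff_of (Abs_mfps f) = f"
  by (simp add: Abs_mfps_inverse)

lemma mdeg_0 [simp]: "mdeg 0 = 0"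
  by (simp add: mdeg_def)

lemma mdeg_add [simp]: "mdeg (p + q) = mdeg p + mdeg q"
  by (simp add: mdeg_def sum.distrib)

lemma mdeg_axis [simp]: "mdeg (axis k c) = c"
  by (simp add: mdeg_def axis_def)

lemma mdeg_eq_0_iff: "mdeg p = 0 \<longleftrightarrow> p = 0"
  by (auto simp: mdeg_def vec_eq_iff)

lemma component_le_mdeg: "p $ k \<le> mdeg p"
  unfolding mdeg_def by (rule member_le_sum) auto

lemma sum_axis: "(\<Sum>k\<in>UNIV. axis k (p $ k)) = (p :: nat ^ 'n::finite)"
  by (auto simp: vec_eq_iff axis_def sum_component)

lemma mdeg_le_1_cases:
  assumes "mdeg q \<le> 1"
  obtains "q = 0" | k where "q = axis k 1"
proof (cases "q = 0")
  case False
  then obtain k where k: "q $ k \<noteq> 0"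
    by (auto simp: vec_eq_iff)
  have "mdeg q = q $ k + (\<Sum>j\<in>UNIV - {k}. q $ j)"
    unfolding mdeg_def by (rule sum.remove) auto
  with assms k have "q $ k = 1" "(\<Sum>j\<in>UNIV - {k}. q $ j) = 0"
    by linarith+
  moreover from this(2) have "\<forall>j\<in>UNIV - {k}. q $ j = 0"
    by (subst (asm) sum_eq_0_iff) auto
  ultimately have "q = axis k 1"
    by (auto simp: vec_eq_iff axis_def)
  then show ?thesis by (rule that)
qed (rule that)

lemma mpower_0 [simp]: "mpower z 0 = 1"
  by (simp add: mpower_def)

lemma mpower_add: "mpower z (p + q) = mpower z p * mpower z q"
  by (simp add: mpower_def power_add prod.distrib)

lemma mpower_const: "mpower (\<chi> k. c) p = c ^ mdeg p"
  by (simp add: mpower_def mdeg_def power_sum)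

lemma norm_mpower_le:
  assumes "\<And>k. norm (z $ k) \<le> \<rho>"
  shows "norm (mpower z p) \<le> \<rho> ^ mdeg p"
proof -
  have "norm (mpower z p) = (\<Prod>k\<in>UNIV. norm (z $ k) ^ (p $ k))"
    by (simp add: mpower_def prod_norm[symmetric] norm_power)
  also have "\<dots> \<le> (\<Prod>k\<in>UNIV. \<rho> ^ (p $ k))"
    using assms by (intro prod_mono) (auto intro: power_mono)
  finally show ?thesis
    by (simp add: mdeg_def power_sum)
qed

lemma coeff_mult_monom: "coeff_of (a * mfps_monom r) (q + r) = coeff_of a q"
proof -
  have "coeff_of (a * mfps_monom r) (q + r)
      = (\<Sum>(u, v)\<in>{(q, r)}. coeff_of a u * coeff_of (mfps_monom r) v)"
    unfolding times_mfps.rep_eq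
    by (rule sum.mono_neutral_right[OF finite_splits]) (auto simp: splits_def coeff_simps split: if_splits)
  then show ?thesis by (simp add: coeff_simps)
qed

lemma coeff_mult_monom_eq_0: "\<forall>q. p \<noteq> q + r \<Longrightarrow> coeff_of (a * mfps_monom r) p = 0"
  unfolding times_mfps.rep_eq by (rule sum.neutral) (auto simp: splits_def coeff_simps)

lemma coeff_const_mult:
  fixes a :: "'a::finite mfps"
  shows "coeff_of (mfps_const c * a) p = c * coeff_of a p"
proof -
  have "coeff_of (mfps_const c * a) p = (\<Sum>(u, v)\<in>{(0, p)}. coeff_of (mfps_const c :: 'a mfps) u * coeff_of a v)"
    unfolding times_mfps.rep_eq
    by (rule sum.mono_neutral_right[OF finite_splits]) (auto simp: splits_def coeff_simps split: if_splits)
  then show ?thesis by (simp add: coeff_simps)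
qed

subsection \<open>Absolute convergence\<close>

text \<open>All pairs \<open>(q, r)\<close> are summed and regrouped by \<open>q + r\<close>; the
  fibres are the finite sets \<open>splits p\<close>. The field is left general because both the
  complex values of series and their real norms are multiplied this way.\<close>

lemma Cauchy_product:
  fixes F G :: "nat ^ 'n::finite \<Rightarrow> 'b :: {real_normed_field, banach}"
  assumes F: "(\<lambda>p. norm (F p)) summable_on UNIV" and G: "(\<lambda>p. norm (G p)) summable_on UNIV"
  shows "((\<lambda>p. \<Sum>(q, r)\<in>splits p. F q * G r) has_sum (infsum F UNIV * infsum G UNIV)) UNIV"
proof -
  have "(\<lambda>x. norm (case x of (q, r) \<Rightarrow> F q * G r)) summable_on (SIGMA q:UNIV. UNIV)"
    using F G by (subst Infinite_Sum.abs_summable_on_Sigma_iff)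
      (auto simp: norm_mult infsum_cmult_right' abs_mult infsum_nonneg
        intro!: summable_on_cmult_right summable_on_cmult_left)
  then have summable: "(\<lambda>(q, r). F q * G r) summable_on (SIGMA q:UNIV. UNIV)"
    by (rule abs_summable_summable)
  then have "infsum (\<lambda>(q, r). F q * G r) (SIGMA q:UNIV. UNIV) = infsum F UNIV * infsum G UNIV"
    by (subst infsum_Sigma'_banach[symmetric]) (auto simp: infsum_cmult_right' infsum_cmult_left')
  with summable have "((\<lambda>(q, r). F q * G r) has_sum (infsum F UNIV * infsum G UNIV)) (UNIV \<times> UNIV)"
    by (simp add: has_sum_iff)
  also have "?this \<longleftrightarrow> ((\<lambda>(p, (q, r)). F q * G r) has_sum (infsum F UNIV * infsum G UNIV)) (SIGMA p:UNIV. splits p)"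
    by (rule has_sum_reindex_bij_witness[of _ snd "\<lambda>(q, r). (q + r, (q, r))"]) (auto simp: splits_def)
  finally show ?thesis
    by (rule has_sum_SigmaD) (auto intro!: has_sum_finite simp: finite_splits case_prod_unfold)
qed

text \<open>Absolute convergence on the closed polydisc of radius \<open>\<rho>\<close>. The
  associated \<open>wnorm \<rho>\<close> is submultiplicative, so that division becomes a
  contraction problem.\<close>

definition abs_conv :: "real \<Rightarrow> 'n::finite mfps \<Rightarrow> bool" where
  "abs_conv \<rho> a \<longleftrightarrow> (\<lambda>p. norm (coeff_of a p) * \<rho> ^ mdeg p) summable_on UNIV"

definition wnorm :: "real \<Rightarrow> 'n::finite mfps \<Rightarrow> real" where
  "wnorm \<rho> a = (\<Sum>\<^sub>\<infinity>p. norm (coeff_of a p) * \<rho> ^ mdeg p)"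

lemma wnorm_nonneg: "\<rho> \<ge> 0 \<Longrightarrow> wnorm \<rho> a \<ge> 0"
  unfolding wnorm_def by (rule infsum_nonneg) simp

lemma abs_conv_leI:
  assumes "g summable_on UNIV" "\<And>p. norm (coeff_of a p) * \<rho> ^ mdeg p \<le> g p" "\<rho> \<ge> 0"
  shows "abs_conv \<rho> a" "wnorm \<rho> a \<le> infsum g UNIV"
proof -
  show 1: "abs_conv \<rho> a"
    unfolding abs_conv_def
    by (rule summable_on_comparison_test[OF assms(1)]) (use assms(2,3) in auto)
  show "wnorm \<rho> a \<le> infsum g UNIV"
    using 1 assms(1,2) unfolding abs_conv_def wnorm_def by (intro infsum_mono) auto
qed

lemma abs_conv_add:
  assumes "abs_conv \<rho> a" "abs_conv \<rho> b" "\<rho> \<ge> 0"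
  shows "abs_conv \<rho> (a + b)" "wnorm \<rho> (a + b) \<le> wnorm \<rho> a + wnorm \<rho> b"
proof -
  let ?g = "\<lambda>p. norm (coeff_of a p) * \<rho> ^ mdeg p + norm (coeff_of b p) * \<rho> ^ mdeg p"
  have g: "?g summable_on UNIV" "infsum ?g UNIV = wnorm \<rho> a + wnorm \<rho> b"
    using assms by (auto simp: abs_conv_def wnorm_def intro!: summable_on_add infsum_add)
  have "norm (coeff_of (a + b) p) * \<rho> ^ mdeg p \<le> ?g p" for p
    using assms(3) by (auto simp: coeff_simps norm_triangle_ineq mult_right_mono simp flip: distrib_right)
  from abs_conv_leI[OF g(1) this assms(3)] show "abs_conv \<rho> (a + b)" "wnorm \<rho> (a + b) \<le> wnorm \<rho> a + wnorm \<rho> b"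
    using g(2) by auto
qed

lemma abs_conv_uminus: "abs_conv \<rho> a \<Longrightarrow> abs_conv \<rho> (- a)"
  and wnorm_uminus: "wnorm \<rho> (- a) = wnorm \<rho> a"
  by (simp_all add: abs_conv_def wnorm_def coeff_simps)

lemma abs_conv_diff:
  assumes "abs_conv \<rho> a" "abs_conv \<rho> b" "\<rho> \<ge> 0"
  shows "abs_conv \<rho> (a - b)" "wnorm \<rho> (a - b) \<le> wnorm \<rho> a + wnorm \<rho> b"
  using abs_conv_add[OF assms(1) abs_conv_uminus[OF assms(2)] assms(3)] by (simp_all add: wnorm_uminus)

lemma abs_conv_finite_support:
  assumes "finite A" "\<And>p. p \<notin> A \<Longrightarrow> coeff_of a p = 0"
  shows "abs_conv \<rho> a"
  unfolding abs_conv_def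
  by (rule finite_nonzero_values_imp_summable_on) (use assms in \<open>auto intro: finite_subset\<close>)

lemma abs_conv_monom [simp]: "abs_conv \<rho> (mfps_monom r)"
  by (rule abs_conv_finite_support[of "{r}"]) (auto simp: coeff_simps)

lemma abs_conv_simps [simp]:
  "abs_conv \<rho> 0" "abs_conv \<rho> 1" "abs_conv \<rho> (mfps_const c)"
  by (rule abs_conv_finite_support[of "{0}"]; simp add: coeff_simps)+

lemma wnorm_0 [simp]: "wnorm \<rho> 0 = 0"
  by (simp add: wnorm_def coeff_simps)

lemma abs_conv_sum:
  assumes "\<And>i. i \<in> A \<Longrightarrow> abs_conv \<rho> (f i)" "\<rho> \<ge> 0"
  shows "abs_conv \<rho> (sum f A) \<and> wnorm \<rho> (sum f A) \<le> (\<Sum>i\<in>A. wnorm \<rho> (f i))"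
  using assms
proof (induction A rule: infinite_finite_induct)
  case (insert i A)
  then show ?case
    using abs_conv_add[of \<rho> "f i" "sum f A"] by fastforce
qed auto

lemma abs_conv_mult:
  assumes "abs_conv \<rho> a" "abs_conv \<rho> b" "\<rho> \<ge> 0"
  shows "abs_conv \<rho> (a * b)" "wnorm \<rho> (a * b) \<le> wnorm \<rho> a * wnorm \<rho> b"
proof -
  let ?F = "\<lambda>a p. norm (coeff_of a p) * \<rho> ^ mdeg p"
  let ?g = "\<lambda>p. \<Sum>(q, r)\<in>splits p. ?F a q * ?F b r"
  have "(?g has_sum (wnorm \<rho> a * wnorm \<rho> b)) UNIV"
    unfolding wnorm_def using assms by (intro Cauchy_product) (auto simp: abs_conv_def abs_mult)
  then have g: "?g summable_on UNIV" "infsum ?g UNIV = wnorm \<rho> a * wnorm \<rho> b"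
    by (auto simp: has_sum_iff)
  have "norm (coeff_of (a * b) p) * \<rho> ^ mdeg p \<le> ?g p" for p
  proof -
    have "norm (coeff_of (a * b) p) \<le> (\<Sum>(q, r)\<in>splits p. norm (coeff_of a q) * norm (coeff_of b r))"
      unfolding times_mfps.rep_eq by (rule order_trans[OF norm_sum]) (auto simp: norm_mult case_prod_unfold)
    then have "norm (coeff_of (a * b) p) * \<rho> ^ mdeg p
        \<le> (\<Sum>(q, r)\<in>splits p. norm (coeff_of a q) * norm (coeff_of b r)) * \<rho> ^ mdeg p"
      using assms(3) by (intro mult_right_mono) auto
    also have "\<dots> = ?g p"
      unfolding sum_distrib_right by (rule sum.cong) (auto simp: splits_def power_add)
    finally show ?thesis .
  qed
  from abs_conv_leI[OF g(1) this assms(3)] show "abs_conv \<rho> (a * b)" "wnorm \<rho> (a * b) \<le> wnorm \<rho> a * wnorm \<rho> b"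
    using g(2) by auto
qed

lemma abs_conv_power: "abs_conv \<rho> a \<Longrightarrow> \<rho> \<ge> 0 \<Longrightarrow> abs_conv \<rho> (a ^ n)"
  by (induction n) (auto intro: abs_conv_mult)

lemma abs_conv_prod: "(\<And>i. i \<in> A \<Longrightarrow> abs_conv \<rho> (f i)) \<Longrightarrow> \<rho> \<ge> 0 \<Longrightarrow> abs_conv \<rho> (prod f A)"
  by (induction A rule: infinite_finite_induct) (auto intro: abs_conv_mult)

definition order_ge :: "nat \<Rightarrow> 'n::finite mfps \<Rightarrow> bool" where
  "order_ge n a \<longleftrightarrow> (\<forall>p. mdeg p < n \<longrightarrow> coeff_of a p = 0)"

text \<open>A term of degree \<open>k\<close> shrinks by \<open>(\<sigma> / \<rho>) ^ k\<close>, and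
  only degrees from \<open>n\<close> on occur. This gain makes the division a contraction on small
  polydiscs and later brings the components of \<open>h\<close> below 1.\<close>

lemma wnorm_shrink:
  assumes "abs_conv \<rho> a" "0 \<le> \<sigma>" "\<sigma> \<le> \<rho>" "\<rho> > 0" "order_ge n a"
  shows "abs_conv \<sigma> a" "wnorm \<sigma> a \<le> (\<sigma> / \<rho>) ^ n * wnorm \<rho> a"
proof -
  let ?g = "\<lambda>p. (\<sigma> / \<rho>) ^ n * (norm (coeff_of a p) * \<rho> ^ mdeg p)"
  have g: "?g summable_on UNIV" "infsum ?g UNIV = (\<sigma> / \<rho>) ^ n * wnorm \<rho> a"
    using assms(1) by (auto simp: abs_conv_def wnorm_def infsum_cmult_right' intro: summable_on_cmult_right)
  have "norm (coeff_of a p) * \<sigma> ^ mdeg p \<le> ?g p" for p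
  proof (cases "mdeg p < n")
    case True
    then show ?thesis using assms(5) by (simp add: order_ge_def)
  next
    case False
    have "\<sigma> ^ mdeg p = (\<sigma> / \<rho>) ^ mdeg p * \<rho> ^ mdeg p"
      using assms(4) by (simp add: power_divide)
    also have "\<dots> \<le> (\<sigma> / \<rho>) ^ n * \<rho> ^ mdeg p"
      using assms False by (intro mult_right_mono power_decreasing) auto
    finally show ?thesis
      by (metis mult.left_commute mult_left_mono norm_ge_zero)
  qed
  from abs_conv_leI[OF g(1) this assms(2)] show "abs_conv \<sigma> a" "wnorm \<sigma> a \<le> (\<sigma> / \<rho>) ^ n * wnorm \<rho> a"
    using g(2) by auto
qed

lemma order_ge_0 [simp]: "order_ge 0 a"
  by (simp add: order_ge_def)

lemma abs_conv_shrink: "abs_conv \<rho> a \<Longrightarrow> 0 \<le> \<sigma> \<Longrightarrow> \<sigma> \<le> \<rho> \<Longrightarrow> \<rho> > 0 \<Longrightarrow> abs_conv \<sigma> a"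
  by (rule wnorm_shrink(1)[where n = 0]) auto

text \<open>One point with all coordinates equal to a small \<open>\<delta>\<close> tests the whole
  series: its monomials are the weights \<open>\<delta> ^ mdeg p\<close>, and summability of complex
  families is absolute.\<close>

lemma mfps_converges_iff: "mfps_converges a \<longleftrightarrow> (\<exists>\<rho>>0. abs_conv \<rho> a)"
proof
  assume "mfps_converges a"
  then obtain e where e: "e > 0" "\<And>z. norm z < e \<Longrightarrow> (\<lambda>p. coeff_of a p * mpower z p) summable_on UNIV"
    unfolding mfps_converges_def eventually_nhds_metric by (auto simp: dist_norm)
  define \<delta> where "\<delta> = e / (2 * real CARD('a))"
  have \<delta>: "\<delta> > 0"
    using e(1) by (simp add: \<delta>_def)
  define z :: "complex ^ 'a" where "z = (\<chi> k. of_real \<delta>)"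
  have "norm z \<le> (\<Sum>k\<in>UNIV. norm (z $ k))"
    unfolding norm_vec_def by (rule L2_set_le_sum) auto
  also have "\<dots> = real CARD('a) * \<delta>"
    using \<delta> by (simp add: z_def)
  also have "\<dots> < e"
    using e(1) by (simp add: \<delta>_def)
  finally have "(\<lambda>p. coeff_of a p * mpower z p) summable_on UNIV"
    by (rule e(2))
  then have "abs_conv \<delta> a"
    using \<delta> unfolding abs_conv_def summable_on_iff_abs_summable_on_complex
    by (simp add: z_def mpower_const norm_mult norm_power)
  with \<delta> show "\<exists>\<rho>>0. abs_conv \<rho> a" by blast
next
  assume "\<exists>\<rho>>0. abs_conv \<rho> a"
  then obtain \<rho> where \<rho>: "\<rho> > 0" "abs_conv \<rho> a" by blast
  have "(\<lambda>p. coeff_of a p * mpower z p) summable_on UNIV" if "norm z < \<rho>" for z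
  proof (rule abs_summable_summable, rule summable_on_comparison_test[OF \<rho>(2)[unfolded abs_conv_def]])
    fix p
    have "norm (mpower z p) \<le> \<rho> ^ mdeg p"
      using that by (intro norm_mpower_le) (meson Finite_Cartesian_Product.norm_nth_le less_imp_le order_trans)
    then show "norm (coeff_of a p * mpower z p) \<le> norm (coeff_of a p) * \<rho> ^ mdeg p"
      by (simp add: norm_mult mult_left_mono)
  qed auto
  then show "mfps_converges a"
    unfolding mfps_converges_def eventually_nhds_metric using \<rho>(1) by (auto simp: dist_norm)
qed

subsection \<open>Evaluation\<close>

lemma abs_summable_eval:
  assumes "abs_conv \<rho> a" "\<And>k. norm (z $ k) \<le> \<rho>"
  shows "(\<lambda>p. norm (coeff_of a p * mpower z p)) summable_on UNIV"
  using assms(1) unfolding abs_conv_def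
  by (rule summable_on_comparison_test) (use norm_mpower_le[OF assms(2)] in \<open>auto simp: norm_mult mult_left_mono\<close>)

lemma has_sum_eval:
  assumes "abs_conv \<rho> a" "\<And>k. norm (z $ k) \<le> \<rho>"
  shows "((\<lambda>p. coeff_of a p * mpower z p) has_sum mfps_eval a z) UNIV"
  unfolding mfps_eval_def
  by (rule has_sum_infsum[OF abs_summable_summable[OF abs_summable_eval[OF assms]]])

lemma norm_eval_le:
  assumes "abs_conv \<rho> a" "\<And>k. norm (z $ k) \<le> \<rho>"
  shows "norm (mfps_eval a z) \<le> wnorm \<rho> a"
proof -
  have "norm (mfps_eval a z) \<le> (\<Sum>\<^sub>\<infinity>p. norm (coeff_of a p * mpower z p))"
    unfolding mfps_eval_def by (rule norm_infsum_bound[OF abs_summable_eval[OF assms]])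
  also have "\<dots> \<le> wnorm \<rho> a"
    unfolding wnorm_def using abs_summable_eval[OF assms] assms(1) norm_mpower_le[OF assms(2)]
    by (intro infsum_mono) (auto simp: norm_mult mult_left_mono abs_conv_def)
  finally show ?thesis .
qed

lemma eval_add:
  assumes "abs_conv \<rho> a" "abs_conv \<rho> b" "\<And>k. norm (z $ k) \<le> \<rho>"
  shows "mfps_eval (a + b) z = mfps_eval a z + mfps_eval b z"
  using has_sum_add[OF has_sum_eval[OF assms(1,3)] has_sum_eval[OF assms(2,3)]]
  by (simp add: coeff_simps distrib_right infsumI mfps_eval_def)

lemma eval_0: "mfps_eval 0 z = 0"
  by (simp add: mfps_eval_def coeff_simps)

lemma eval_1: "mfps_eval 1 z = 1"
proof -
  have "((\<lambda>p. coeff_of 1 p * mpower z p) has_sum 1) UNIV"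
    by (rule has_sum_finite_neutralI[of "{0}"]) (auto simp: coeff_simps)
  then show ?thesis
    by (simp add: infsumI mfps_eval_def)
qed

lemma eval_sum:
  assumes "\<And>i. i \<in> A \<Longrightarrow> abs_conv \<rho> (f i)" "\<And>k. norm (z $ k) \<le> \<rho>" "\<rho> \<ge> 0"
  shows "mfps_eval (sum f A) z = (\<Sum>i\<in>A. mfps_eval (f i) z)"
  using assms(1)
proof (induction A rule: infinite_finite_induct)
  case (insert i A)
  then show ?case
    using eval_add[of \<rho> "f i" "sum f A" z] abs_conv_sum[of A \<rho> f] assms(2,3) by simp
qed (auto simp: eval_0)

lemma eval_mult:
  assumes "abs_conv \<rho> a" "abs_conv \<rho> b" "\<And>k. norm (z $ k) \<le> \<rho>"
  shows "mfps_eval (a * b) z = mfps_eval a z * mfps_eval b z"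
proof -
  have "((\<lambda>p. \<Sum>(q, r)\<in>splits p. (coeff_of a q * mpower z q) * (coeff_of b r * mpower z r))
      has_sum (mfps_eval a z * mfps_eval b z)) UNIV"
    unfolding mfps_eval_def
    by (intro Cauchy_product abs_summable_eval[OF assms(1,3)] abs_summable_eval[OF assms(2,3)])
  also have "(\<lambda>p. \<Sum>(q, r)\<in>splits p. (coeff_of a q * mpower z q) * (coeff_of b r * mpower z r))
      = (\<lambda>p. coeff_of (a * b) p * mpower z p)"
    unfolding times_mfps.rep_eq sum_distrib_right
    by (intro ext sum.cong) (auto simp: splits_def mpower_add)
  finally show ?thesis
    by (simp add: infsumI mfps_eval_def)
qed

lemma eval_const: "mfps_eval (mfps_const c) z = c"
proof -
  have "((\<lambda>p. coeff_of (mfps_const c) p * mpower z p) has_sum c) UNIV"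
    by (rule has_sum_finite_neutralI[of "{0}"]) (auto simp: coeff_simps)
  then show ?thesis
    by (simp add: infsumI mfps_eval_def)
qed

lemma eval_power:
  assumes "abs_conv \<rho> a" "\<And>k. norm (z $ k) \<le> \<rho>" "\<rho> \<ge> 0"
  shows "mfps_eval (a ^ n) z = mfps_eval a z ^ n"
  using assms by (induction n) (auto simp: eval_1 eval_mult abs_conv_power)

lemma eval_prod:
  assumes "\<And>i. i \<in> A \<Longrightarrow> abs_conv \<rho> (f i)" "\<And>k. norm (z $ k) \<le> \<rho>" "\<rho> \<ge> 0"
  shows "mfps_eval (prod f A) z = (\<Prod>i\<in>A. mfps_eval (f i) z)"
  using assms(1)
proof (induction A rule: infinite_finite_induct)
  case (insert i A)
  then show ?case
    using eval_mult[of \<rho> "f i" "prod f A" z] abs_conv_prod[of A \<rho> f] assms(2,3) by simp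
qed (auto simp: eval_1)

text \<open>Differentiation brings in the factor \<open>p $ k + 1\<close>, at most
  \<open>2 ^ mdeg p\<close>; halving the radius pays for it.\<close>

lemma abs_conv_deriv:
  assumes "abs_conv \<rho> a" "\<rho> > 0"
  shows "abs_conv (\<rho> / 2) (mfps_deriv k a)"
proof -
  let ?f = "\<lambda>p. norm (coeff_of a p) * \<rho> ^ mdeg p"
  let ?g = "\<lambda>p. (1 / \<rho>) * ?f (p + axis k 1)"
  have inj: "inj (\<lambda>p. p + axis k (1::nat))"
    by (rule injI) simp
  have "?f summable_on range (\<lambda>p. p + axis k 1)"
    using assms(1) unfolding abs_conv_def by (rule summable_on_subset_banach) auto
  then have "(\<lambda>p. ?f (p + axis k 1)) summable_on UNIV"
    by (subst (asm) summable_on_reindex[OF inj]) (simp add: o_def)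
  then have g: "?g summable_on UNIV"
    by (rule summable_on_cmult_right)
  have "norm (coeff_of (mfps_deriv k a) p) * (\<rho> / 2) ^ mdeg p \<le> ?g p" for p
  proof -
    have "real (p $ k + 1) \<le> 2 ^ mdeg p"
    proof -
      have "p $ k + 1 \<le> mdeg p + 1"
        using component_le_mdeg[of p k] by simp
      also have "\<dots> \<le> 2 ^ mdeg p"
        by (induction "mdeg p") (auto simp: Suc_leI less_exp)
      finally show ?thesis
        by (metis of_nat_le_iff of_nat_numeral of_nat_power)
    qed
    then have "real (p $ k + 1) * (norm (coeff_of a (p + axis k 1)) * (\<rho> / 2) ^ mdeg p)
        \<le> 2 ^ mdeg p * (norm (coeff_of a (p + axis k 1)) * (\<rho> / 2) ^ mdeg p)"
      using assms(2) by (intro mult_right_mono) auto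
    then show ?thesis
      using assms(2)
      by (simp add: mfps_deriv.rep_eq norm_mult field_simps del: of_nat_Suc of_nat_add)
  qed
  from abs_conv_leI(1)[OF g this] show ?thesis
    using assms(2) by simp
qed

text \<open>The partial derivative of \<open>mpower z p\<close> in \<open>z $ k\<close>. For
  \<open>p $ k = 0\<close> the truncated exponent is harmless because the first factor
  vanishes.\<close>

definition dmpower :: "'n::finite \<Rightarrow> complex ^ 'n \<Rightarrow> nat ^ 'n \<Rightarrow> complex" where
  "dmpower k z p = of_nat (p $ k) * (z $ k) ^ (p $ k - 1) * (\<Prod>j\<in>UNIV - {k}. (z $ j) ^ (p $ j))"

lemma dmpower_add_axis: "dmpower k z (q + axis k 1) = of_nat (q $ k + 1) * mpower z q"
proof -
  have "(\<Prod>j\<in>UNIV - {k}. (z $ j) ^ ((q + axis k 1) $ j)) = (\<Prod>j\<in>UNIV - {k}. (z $ j) ^ (q $ j))"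
    by (rule prod.cong) (auto simp: axis_def)
  moreover have "mpower z q = (z $ k) ^ (q $ k) * (\<Prod>j\<in>UNIV - {k}. (z $ j) ^ (q $ j))"
    unfolding mpower_def by (rule prod.remove) auto
  ultimately show ?thesis
    by (simp add: dmpower_def axis_def)
qed

lemma mpower_has_field_derivative:
  assumes "\<And>k. ((\<lambda>\<sigma>. \<gamma> \<sigma> $ k) has_field_derivative V k) (at \<tau>)"
  shows "((\<lambda>\<sigma>. mpower (\<gamma> \<sigma>) p) has_field_derivative (\<Sum>k\<in>UNIV. dmpower k (\<gamma> \<tau>) p * V k)) (at \<tau>)"
proof -
  have "((\<lambda>\<sigma>. (\<gamma> \<sigma> $ k) ^ (p $ k)) has_field_derivative
      of_nat (p $ k) * (\<gamma> \<tau> $ k) ^ (p $ k - 1) * V k) (at \<tau>)" for k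
    using assms[of k] by (auto intro!: derivative_eq_intros)
  from has_field_derivative_prod[of UNIV "\<lambda>k \<sigma>. (\<gamma> \<sigma> $ k) ^ (p $ k)", OF this]
  show ?thesis
    by (simp add: mpower_def dmpower_def mult_ac)
qed

lemma has_sum_eval_deriv:
  assumes "abs_conv \<rho> a" "\<rho> > 0" "\<And>k. norm (z $ k) \<le> \<rho> / 2"
  shows "((\<lambda>p. coeff_of a p * dmpower k z p) has_sum mfps_eval (mfps_deriv k a) z) UNIV"
proof -
  have inj: "inj (\<lambda>p. p + axis k (1::nat))"
    by (rule injI) simp
  have "((\<lambda>q. coeff_of (mfps_deriv k a) q * mpower z q) has_sum mfps_eval (mfps_deriv k a) z) UNIV"
    using abs_conv_deriv[OF assms(1,2)] assms(3) by (rule has_sum_eval)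
  also have "(\<lambda>q. coeff_of (mfps_deriv k a) q * mpower z q)
      = (\<lambda>p. coeff_of a p * dmpower k z p) \<circ> (\<lambda>p. p + axis k 1)"
    by (simp only: fun_eq_iff o_def dmpower_add_axis mfps_deriv.rep_eq) (simp add: mult_ac)
  finally have "((\<lambda>p. coeff_of a p * dmpower k z p) has_sum mfps_eval (mfps_deriv k a) z)
      (range (\<lambda>p. p + axis k 1))"
    by (subst has_sum_reindex[OF inj])
  moreover have "dmpower k z p = 0" if "p \<notin> range (\<lambda>p. p + axis k 1)" for p
  proof (rule ccontr)
    assume "dmpower k z p \<noteq> 0"
    then have "p $ k \<noteq> 0" by (auto simp: dmpower_def)
    then have "p = (\<chi> j. if j = k then p $ j - 1 else p $ j) + axis k 1"
      by (auto simp: vec_eq_iff axis_def)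
    with that show False by blast
  qed
  ultimately show ?thesis
    by (subst has_sum_cong_neutral[where S = UNIV and T = "range (\<lambda>p. p + axis k 1)"]) auto
qed

text \<open>Termwise differentiation along the curve: the finite partial sums converge uniformly
  near \<open>\<tau>\<close> by the Weierstrass test, so their derivatives converge to that of the
  limit. This stays within functions of one complex variable.\<close>

theorem eval_chain_rule:
  fixes \<gamma> :: "complex \<Rightarrow> complex ^ 'n::finite"
  assumes a: "abs_conv \<rho> a" "\<rho> > 0" and D: "open D" "\<tau> \<in> D"
    and \<gamma>: "\<And>\<sigma> k. \<sigma> \<in> D \<Longrightarrow> ((\<lambda>\<sigma>. \<gamma> \<sigma> $ k) has_field_derivative V \<sigma> k) (at \<sigma>)"
      "\<And>\<sigma> k. \<sigma> \<in> D \<Longrightarrow> norm (\<gamma> \<sigma> $ k) \<le> \<rho> / 2"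
  shows "((\<lambda>\<sigma>. mfps_eval a (\<gamma> \<sigma>)) has_field_derivative
           (\<Sum>k\<in>UNIV. mfps_eval (mfps_deriv k a) (\<gamma> \<tau>) * V \<tau> k)) (at \<tau>)"
proof -
  obtain e where e: "e > 0" "cball \<tau> e \<subseteq> D"
    using D open_contains_cball by blast
  define f where "f X \<sigma> = (\<Sum>p\<in>X. coeff_of a p * mpower (\<gamma> \<sigma>) p)" for X \<sigma>
  define f' where "f' X \<sigma> = (\<Sum>p\<in>X. coeff_of a p * (\<Sum>k\<in>UNIV. dmpower k (\<gamma> \<sigma>) p * V \<sigma> k))" for X \<sigma>
  have \<gamma>': "norm (\<gamma> \<sigma> $ k) \<le> \<rho>" if "\<sigma> \<in> D" for \<sigma> k
    using \<gamma>(2)[OF that, of k] a(2) by simp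
  have deriv: "(f X has_field_derivative f' X \<sigma>) (at \<sigma>)" if "\<sigma> \<in> D" for X \<sigma>
    unfolding f_def f'_def
    by (intro DERIV_sum DERIV_cmult mpower_has_field_derivative \<gamma>(1) that)
  have "\<forall>\<^sub>F X in finite_subsets_at_top UNIV. continuous_on (cball \<tau> e) (f X) \<and>
      (\<forall>\<sigma>\<in>ball \<tau> e. (f X has_field_derivative f' X \<sigma>) (at \<sigma>))"
  proof (intro always_eventually allI conjI ballI)
    fix X show "continuous_on (cball \<tau> e) (f X)"
      by (rule DERIV_continuous_on[of _ _ "f' X"], rule has_field_derivative_at_within, rule deriv)
        (use e(2) in auto)
  next
    fix X \<sigma> assume "\<sigma> \<in> ball \<tau> e"
    then show "(f X has_field_derivative f' X \<sigma>) (at \<sigma>)"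
      using e(2) by (intro deriv) auto
  qed
  moreover have "uniform_limit (cball \<tau> e) f (\<lambda>\<sigma>. mfps_eval a (\<gamma> \<sigma>)) (finite_subsets_at_top UNIV)"
    unfolding f_def mfps_eval_def
  proof (rule Weierstrass_m_test_general)
    fix p \<sigma> assume "\<sigma> \<in> cball \<tau> e"
    then have "norm (mpower (\<gamma> \<sigma>) p) \<le> \<rho> ^ mdeg p"
      using e(2) by (intro norm_mpower_le \<gamma>') auto
    then show "norm (coeff_of a p * mpower (\<gamma> \<sigma>) p) \<le> norm (coeff_of a p) * \<rho> ^ mdeg p"
      by (simp add: norm_mult mult_left_mono)
  qed (use a(1) in \<open>simp add: abs_conv_def\<close>)
  ultimately obtain g' where g': "((\<lambda>\<sigma>. mfps_eval a (\<gamma> \<sigma>)) has_field_derivative g' \<tau>) (at \<tau>)"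
    "((\<lambda>X. f' X \<tau>) \<longlongrightarrow> g' \<tau>) (finite_subsets_at_top UNIV)"
    using has_complex_derivative_uniform_limit[of \<tau> e f f' "finite_subsets_at_top UNIV"
        "\<lambda>\<sigma>. mfps_eval a (\<gamma> \<sigma>)"] e(1) by (metis centre_in_ball finite_subsets_at_top_neq_bot)
  have "f' X \<tau> = (\<Sum>k\<in>UNIV. (\<Sum>p\<in>X. coeff_of a p * dmpower k (\<gamma> \<tau>) p) * V \<tau> k)" for X
    unfolding f'_def sum_distrib_left sum_distrib_right by (subst sum.swap) (simp add: mult_ac)
  moreover have "((\<lambda>X. \<Sum>k\<in>UNIV. (\<Sum>p\<in>X. coeff_of a p * dmpower k (\<gamma> \<tau>) p) * V \<tau> k) \<longlongrightarrow>
      (\<Sum>k\<in>UNIV. mfps_eval (mfps_deriv k a) (\<gamma> \<tau>) * V \<tau> k)) (finite_subsets_at_top UNIV)"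
    using has_sum_eval_deriv[OF a \<gamma>(2)[OF D(2)]] unfolding has_sum_def
    by (intro tendsto_sum tendsto_mult_right)
  ultimately have "((\<lambda>X. f' X \<tau>) \<longlongrightarrow> (\<Sum>k\<in>UNIV. mfps_eval (mfps_deriv k a) (\<gamma> \<tau>) * V \<tau> k))
      (finite_subsets_at_top UNIV)"
    by simp
  with g'(2) have "g' \<tau> = (\<Sum>k\<in>UNIV. mfps_eval (mfps_deriv k a) (\<gamma> \<tau>) * V \<tau> k)"
    by (intro tendsto_unique[OF finite_subsets_at_top_neq_bot])
  with g'(1) show ?thesis by simp
qed

subsection \<open>Division by series with monomial leading terms\<close>

lemma order_ge_diff: "order_ge n a \<Longrightarrow> order_ge n b \<Longrightarrow> order_ge n (a - b)"
  by (simp add: order_ge_def coeff_simps)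

lemma order_ge_sum: "(\<And>i. i \<in> A \<Longrightarrow> order_ge n (f i)) \<Longrightarrow> order_ge n (sum f A)"
  by (simp add: order_ge_def coeff_sum)

lemma order_ge_mult:
  assumes "order_ge m a" "order_ge n b"
  shows "order_ge (m + n) (a * b)"
  unfolding order_ge_def times_mfps.rep_eq
proof (intro allI impI sum.neutral ballI)
  fix p and x :: "(nat ^ 'a) \<times> (nat ^ 'a)"
  assume "mdeg p < m + n" "x \<in> splits p"
  then have "mdeg (fst x) < m \<or> mdeg (snd x) < n"
    by (auto simp: splits_def)
  with assms show "(case x of (q, r) \<Rightarrow> coeff_of a q * coeff_of b r) = 0"
    by (auto simp: order_ge_def case_prod_unfold)
qed

text \<open>The lowest homogeneous part is a single monomial, so total degree can serve in place of
  a monomial order.\<close>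

definition leading :: "'n::finite mfps \<Rightarrow> nat ^ 'n \<Rightarrow> bool" where
  "leading a p \<longleftrightarrow> (\<forall>q. mdeg q \<le> mdeg p \<longrightarrow> coeff_of a q = (if q = p then 1 else 0))"

lemma leading_1: "leading 1 0"
  by (simp add: leading_def mdeg_eq_0_iff coeff_simps)

lemma leading_mult:
  assumes "leading a p" "leading b p'"
  shows "leading (a * b) (p + p')"
  unfolding leading_def
proof (intro allI impI)
  fix q :: "nat ^ 'a" assume q: "mdeg q \<le> mdeg (p + p')"
  have "(\<Sum>(u, v)\<in>splits q. coeff_of a u * coeff_of b v) = (\<Sum>(u, v)\<in>splits q \<inter> {(p, p')}. 1)"
  proof (rule sum.mono_neutral_cong_right)
    show "\<forall>x\<in>splits q - splits q \<inter> {(p, p')}. (case x of (u, v) \<Rightarrow> coeff_of a u * coeff_of b v) = 0"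
    proof
      fix x assume x: "x \<in> splits q - splits q \<inter> {(p, p')}"
      obtain u v where uv: "x = (u, v)" by (cases x)
      have "mdeg u + mdeg v \<le> mdeg p + mdeg p'" "(u, v) \<noteq> (p, p')"
        using x q by (auto simp: uv splits_def)
      moreover have "coeff_of a u = 0" if "mdeg u \<le> mdeg p" "u \<noteq> p"
        using assms(1) that by (simp add: leading_def)
      moreover have "coeff_of b v = 0" if "mdeg v \<le> mdeg p'" "v \<noteq> p'"
        using assms(2) that by (simp add: leading_def)
      ultimately have "coeff_of a u = 0 \<or> coeff_of b v = 0"
        by (cases "u = p"; cases "v = p'"; cases "mdeg u \<le> mdeg p") auto
      then show "(case x of (u, v) \<Rightarrow> coeff_of a u * coeff_of b v) = 0"
        by (auto simp: uv)
    qed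
  qed (use assms in \<open>auto simp: finite_splits leading_def\<close>)
  also have "\<dots> = (if q = p + p' then 1 else 0)"
    by (auto simp: splits_def)
  finally show "coeff_of (a * b) q = (if q = p + p' then 1 else 0)"
    by (simp add: times_mfps.rep_eq)
qed

lemma leading_power:
  assumes "leading a (axis k 1)"
  shows "leading (a ^ n) (axis k n)"
proof (induction n)
  case 0
  have "axis k 0 = (0 :: nat ^ 'a)"
    by (simp add: vec_eq_iff axis_def)
  then show ?case by (simp only: power_0 leading_1)
next
  case (Suc n)
  have "axis k 1 + axis k n = axis k (Suc n)"
    by (auto simp: vec_eq_iff axis_def)
  then show ?case
    using leading_mult[OF assms Suc] by simp
qed

lemma leading_prod:
  "(\<And>i. i \<in> A \<Longrightarrow> leading (f i) (p i)) \<Longrightarrow> leading (prod f A) (sum p A)"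
  by (induction A rule: infinite_finite_induct) (auto intro: leading_1 leading_mult)

text \<open>Each \<open>h k\<close> is its own variable plus higher terms, and leading monomials
  multiply. Expansion in powers of \<open>h\<close> is thus triangular in the degree with unit
  diagonal, which underlies both the division and the comparison of initial terms.\<close>

lemma leading_tangent_to_identity:
  assumes "tangent_to_identity h"
  shows "leading (\<Prod>k\<in>UNIV. h k ^ (p $ k)) p"
proof -
  have "leading (h k) (axis k 1)" for k
    unfolding leading_def
  proof (intro allI impI)
    fix q :: "nat ^ 'a" assume "mdeg q \<le> mdeg (axis k 1 :: nat ^ 'a)"
    then have "mdeg q \<le> 1" by simp
    then show "coeff_of (h k) q = (if q = axis k 1 then 1 else 0)"
      using assms
      by (cases rule: mdeg_le_1_cases) (auto simp: tangent_to_identity_def axis_eq_axis)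
  qed
  then have "leading (\<Prod>k\<in>UNIV. h k ^ (p $ k)) (\<Sum>k\<in>UNIV. axis k (p $ k))"
    by (intro leading_prod leading_power)
  then show ?thesis
    by (simp add: sum_axis)
qed

text \<open>
  With \<open>b s = mfps_monom (r s) + e s\<close> and \<open>D s a\<close> the quotients of the division of \<open>a\<close> by the monomials,
  the equation to be solved is \<open>F = H + (\<Sum>s\<in>S. D s H * e s)\<close>. As \<open>e s\<close> has order greater than
  \<open>mdeg (r s)\<close>, the sum is a contraction in \<open>H\<close> for the norm \<open>wnorm \<rho>\<close> with small \<open>\<rho>\<close>.
\<close>

theorem convergent_division:
  fixes b :: "'s \<Rightarrow> 'n::finite mfps"
  assumes S: "finite S" and lead: "\<And>s. s \<in> S \<Longrightarrow> leading (b s) (r s)"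
    and conv: "\<And>s. s \<in> S \<Longrightarrow> abs_conv \<rho>0 (b s)" "abs_conv \<rho>0 F" "\<rho>0 > 0"
  obtains \<rho> c R where "\<rho> > 0" "\<rho> \<le> \<rho>0" "\<And>s. s \<in> S \<Longrightarrow> abs_conv \<rho> (c s)"
    "F = (\<Sum>s\<in>S. c s * b s) + R" "\<And>s q. s \<in> S \<Longrightarrow> coeff_of R (q + r s) = 0"
proof -
  \<comment> \<open>A monomial may be divisible by several \<open>r s\<close>; fixing one choice per
    monomial makes the quotients \<open>D s\<close> well defined and linear.\<close>
  define sel where "sel p = (SOME s. s \<in> S \<and> (\<exists>q. p = q + r s))" for p
  have sel: "sel (q + r s) \<in> S \<and> (\<exists>q'. q + r s = q' + r (sel (q + r s)))" if "s \<in> S" for s q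
    unfolding sel_def by (rule someI[of _ s]) (use that in auto)
  define D where "D s a = Abs_mfps (\<lambda>q. if sel (q + r s) = s then coeff_of a (q + r s) else 0)" for s a
  define Rm where "Rm a = Abs_mfps (\<lambda>p. if \<exists>s\<in>S. \<exists>q. p = q + r s then 0 else coeff_of a p)"
    for a :: "'n mfps"
  define e where "e s = b s - mfps_monom (r s)" for s
  define T where "T a = (\<Sum>s\<in>S. D s a * e s)" for a
  have decomp: "a = (\<Sum>s\<in>S. D s a * mfps_monom (r s)) + Rm a" for a
  proof (rule mfps_eqI)
    fix p
    show "coeff_of a p = coeff_of ((\<Sum>s\<in>S. D s a * mfps_monom (r s)) + Rm a) p"
    proof (cases "\<exists>s\<in>S. \<exists>q. p = q + r s")
      case True
      then obtain q where q: "sel p \<in> S" "p = q + r (sel p)"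
        using sel by metis
      have "coeff_of (D s a * mfps_monom (r s)) p = (if s = sel p then coeff_of a p else 0)" for s
      proof (cases "\<exists>q. p = q + r s")
        case True
        then obtain q' where "p = q' + r s" by blast
        then show ?thesis
          by (auto simp: coeff_mult_monom D_def)
      next
        case False
        then show ?thesis
          using q(2) by (auto simp: coeff_mult_monom_eq_0)
      qed
      with True q(1) S show ?thesis
        by (simp add: coeff_simps coeff_sum Rm_def)
    next
      case False
      then have "coeff_of (D s a * mfps_monom (r s)) p = 0" if "s \<in> S" for s
        using that by (intro coeff_mult_monom_eq_0) auto
      with False show ?thesis
        by (simp add: coeff_simps coeff_sum Rm_def)
    qed
  qed
  have order_e: "order_ge (mdeg (r s) + 1) (e s)" if "s \<in> S" for s
    using lead[OF that] by (auto simp: order_ge_def e_def coeff_simps leading_def)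
  have conv_e: "abs_conv \<rho>0 (e s)" if "s \<in> S" for s
    unfolding e_def using conv that by (intro abs_conv_diff) auto
  \<comment> \<open>Dividing by the monomial costs \<open>\<rho> ^ mdeg (r s)\<close>, while
    shrinking \<open>e s\<close> to radius \<open>\<rho>\<close> gains one power more. The net
    factor of \<open>T\<close> is \<open>\<rho> * B\<close>, and \<open>\<rho>\<close> is chosen to
    make it at most \<open>1 / 2\<close>.\<close>
  define B where "B = (\<Sum>s\<in>S. wnorm \<rho>0 (e s) / \<rho>0 ^ (mdeg (r s) + 1))"
  have B: "B \<ge> 0"
    unfolding B_def using conv(3) by (intro sum_nonneg divide_nonneg_nonneg wnorm_nonneg) auto
  define \<rho> where "\<rho> = min \<rho>0 (1 / (2 * (B + 1)))"
  have \<rho>: "\<rho> > 0" "\<rho> \<le> \<rho>0" "\<rho> * B \<le> 1 / 2"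
  proof -
    show "\<rho> > 0" "\<rho> \<le> \<rho>0"
      using B conv(3) by (auto simp: \<rho>_def)
    have "\<rho> * B \<le> (1 / (2 * (B + 1))) * B"
      using B by (intro mult_right_mono) (auto simp: \<rho>_def)
    also have "\<dots> \<le> 1 / 2"
      using B by (simp add: field_simps)
    finally show "\<rho> * B \<le> 1 / 2" .
  qed
  have conv_D: "abs_conv \<rho> (D s a)" "wnorm \<rho> (D s a) \<le> wnorm \<rho> a / \<rho> ^ mdeg (r s)"
    if "abs_conv \<rho> a" for s a
  proof -
    let ?f = "\<lambda>p. norm (coeff_of a p) * \<rho> ^ mdeg p"
    let ?g = "\<lambda>q. (1 / \<rho> ^ mdeg (r s)) * ?f (q + r s)"
    have inj: "inj (\<lambda>q. q + r s)"
      by (rule injI) simp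
    have range: "?f summable_on range (\<lambda>q. q + r s)"
      using that unfolding abs_conv_def by (rule summable_on_subset_banach) auto
    then have shift: "(\<lambda>q. ?f (q + r s)) summable_on UNIV"
      by (subst (asm) summable_on_reindex[OF inj]) (simp add: o_def)
    then have g: "?g summable_on UNIV"
      by (rule summable_on_cmult_right)
    have "(\<Sum>\<^sub>\<infinity>q. ?f (q + r s)) = (\<Sum>\<^sub>\<infinity>p\<in>range (\<lambda>q. q + r s). ?f p)"
      by (subst infsum_reindex[OF inj]) (simp add: o_def)
    also have "\<dots> \<le> wnorm \<rho> a"
      unfolding wnorm_def using range that \<rho>(1) by (intro infsum_mono2) (auto simp: abs_conv_def)
    finally have le: "infsum ?g UNIV \<le> wnorm \<rho> a / \<rho> ^ mdeg (r s)"
      using \<rho>(1) by (subst infsum_cmult_right') (simp add: divide_right_mono)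
    have "norm (coeff_of (D s a) q) * \<rho> ^ mdeg q \<le> ?g q" for q
      using \<rho>(1) by (simp add: D_def power_add)
    from abs_conv_leI[OF g this] \<rho>(1) le
    show "abs_conv \<rho> (D s a)" "wnorm \<rho> (D s a) \<le> wnorm \<rho> a / \<rho> ^ mdeg (r s)"
      by auto
  qed
  have conv_T: "abs_conv \<rho> (T a)" "wnorm \<rho> (T a) \<le> wnorm \<rho> a / 2" if a: "abs_conv \<rho> a" for a
  proof -
    have e: "abs_conv \<rho> (e s)"
      "wnorm \<rho> (e s) \<le> (\<rho> / \<rho>0) ^ (mdeg (r s) + 1) * wnorm \<rho>0 (e s)" if "s \<in> S" for s
      using wnorm_shrink[OF conv_e _ \<rho>(2) conv(3) order_e] that \<rho>(1) by auto
    have term_conv: "abs_conv \<rho> (D s a * e s)" if "s \<in> S" for s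
      using conv_D[OF a] e[OF that] \<rho>(1) by (intro abs_conv_mult) auto
    have term_le: "wnorm \<rho> (D s a * e s) \<le> wnorm \<rho> a * (\<rho> * (wnorm \<rho>0 (e s) / \<rho>0 ^ (mdeg (r s) + 1)))"
      if "s \<in> S" for s
    proof -
      have "wnorm \<rho> (D s a * e s) \<le> wnorm \<rho> (D s a) * wnorm \<rho> (e s)"
        using conv_D[OF a] e[OF that] \<rho>(1) by (intro abs_conv_mult) auto
      also have "\<dots> \<le> (wnorm \<rho> a / \<rho> ^ mdeg (r s)) * ((\<rho> / \<rho>0) ^ (mdeg (r s) + 1) * wnorm \<rho>0 (e s))"
        using conv_D[OF a] e[OF that] \<rho>(1) by (intro mult_mono) (auto intro!: wnorm_nonneg divide_nonneg_nonneg)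
      also have "\<dots> = wnorm \<rho> a * (\<rho> * (wnorm \<rho>0 (e s) / \<rho>0 ^ (mdeg (r s) + 1)))"
        using \<rho>(1) conv(3) by (simp add: power_divide)
      finally show ?thesis .
    qed
    show "abs_conv \<rho> (T a)"
      unfolding T_def using abs_conv_sum[of S \<rho> "\<lambda>s. D s a * e s"] term_conv \<rho>(1) by auto
    have "wnorm \<rho> (T a) \<le> (\<Sum>s\<in>S. wnorm \<rho> (D s a * e s))"
      unfolding T_def using abs_conv_sum[of S \<rho> "\<lambda>s. D s a * e s"] term_conv \<rho>(1) by auto
    also have "\<dots> \<le> (\<Sum>s\<in>S. wnorm \<rho> a * (\<rho> * (wnorm \<rho>0 (e s) / \<rho>0 ^ (mdeg (r s) + 1))))"
      by (rule sum_mono) (rule term_le)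
    also have "\<dots> = wnorm \<rho> a * (\<rho> * B)"
      by (simp add: B_def sum_distrib_left)
    also have "\<dots> \<le> wnorm \<rho> a * (1 / 2)"
      using \<rho> by (intro mult_left_mono wnorm_nonneg) auto
    finally show "wnorm \<rho> (T a) \<le> wnorm \<rho> a / 2" by simp
  qed
  have D_diff: "D s (a - a') = D s a - D s a'" for s a a'
    by (rule mfps_eqI) (simp add: D_def coeff_simps)
  have T_diff: "T (a - a') = T a - T a'" for a a'
    by (simp add: T_def D_diff left_diff_distrib sum_subtractf)
  \<comment> \<open>\<open>T\<close> also raises the order, which makes the iteration below
    stationary in each degree. If \<open>n < mdeg (r s)\<close>, the truncated difference is
    \<open>0\<close> and the order of \<open>e s\<close> alone suffices.\<close>
  have T_order: "order_ge (n + 1) (T a)" if "order_ge n a" for n a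
    unfolding T_def
  proof (rule order_ge_sum)
    fix s assume s: "s \<in> S"
    have "order_ge (n - mdeg (r s)) (D s a)"
      using that by (auto simp: order_ge_def D_def)
    from order_ge_mult[OF this order_e[OF s]] show "order_ge (n + 1) (D s a * e s)"
      by (auto simp: order_ge_def)
  qed
  have conv_F: "abs_conv \<rho> F"
    by (rule abs_conv_shrink[OF conv(2)]) (use conv(3) \<rho> in auto)
  \<comment> \<open>Iteration for \<open>H = F - T H\<close>. The limit is taken coefficientwise,
    and the bound \<open>2 * wnorm \<rho> F\<close>, preserved because \<open>T\<close> halves
    norms, passes to it through finite partial sums.\<close>
  define G where "G = rec_nat 0 (\<lambda>_ a. F - T a)"
  have G_0: "G 0 = 0" and G_Suc: "G (Suc n) = F - T (G n)" for n
    by (simp_all add: G_def)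
  have G: "abs_conv \<rho> (G n) \<and> wnorm \<rho> (G n) \<le> 2 * wnorm \<rho> F" for n
  proof (induction n)
    case 0
    then show ?case using \<rho>(1) wnorm_nonneg[of \<rho> F] by (simp add: G_0)
  next
    case (Suc n)
    then have "abs_conv \<rho> (T (G n))" "wnorm \<rho> (T (G n)) \<le> wnorm \<rho> (G n) / 2"
      using conv_T by auto
    then show ?case
      using Suc abs_conv_diff[OF conv_F, of "T (G n)"] \<rho>(1) by (auto simp: G_Suc)
  qed
  have G_step: "order_ge n (G (Suc n) - G n)" for n
  proof (induction n)
    case (Suc n)
    have "order_ge (Suc n) (T (G n - G (Suc n)))"
      using T_order[of n "G n - G (Suc n)"] Suc by (simp add: order_ge_def coeff_simps)
    also have "T (G n - G (Suc n)) = (F - T (G (Suc n))) - (F - T (G n))"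
      by (simp add: T_diff)
    also have "\<dots> = G (Suc (Suc n)) - G (Suc n)"
      by (simp only: G_Suc[of "Suc n"] G_Suc[of n, symmetric])
    finally show ?case .
  qed simp
  define H where "H = Abs_mfps (\<lambda>p. coeff_of (G (Suc (mdeg p))) p)"
  have H: "coeff_of (G n) p = coeff_of H p" if "mdeg p < n" for n p
    using that
  proof (induction n)
    case (Suc n)
    show ?case
    proof (cases "n = mdeg p")
      case True
      then show ?thesis by (simp add: H_def)
    next
      case False
      then have "mdeg p < n" using Suc.prems by simp
      then have "coeff_of (G (Suc n)) p = coeff_of (G n) p"
        using G_step[of n] by (simp add: order_ge_def coeff_simps)
      then show ?thesis using Suc.IH \<open>mdeg p < n\<close> by simp
    qed
  qed simp
  have "abs_conv \<rho> H"
    unfolding abs_conv_def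
  proof (rule nonneg_bounded_partial_sums_imp_summable_on[where C = "2 * wnorm \<rho> F"])
    show "\<forall>\<^sub>F X in finite_subsets_at_top UNIV.
        (\<Sum>p\<in>X. norm (coeff_of H p) * \<rho> ^ mdeg p) \<le> 2 * wnorm \<rho> F"
    proof (rule eventually_finite_subsets_at_top_weakI)
      fix X :: "(nat ^ 'n) set" assume X: "finite X"
      obtain n where n: "\<And>p. p \<in> X \<Longrightarrow> mdeg p < n"
        using finite_nat_set_iff_bounded[of "mdeg ` X"] X by auto
      have "(\<Sum>p\<in>X. norm (coeff_of H p) * \<rho> ^ mdeg p) = (\<Sum>p\<in>X. norm (coeff_of (G n) p) * \<rho> ^ mdeg p)"
        by (rule sum.cong) (simp_all add: H n)
      also have "\<dots> \<le> wnorm \<rho> (G n)"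
        unfolding wnorm_def using G[of n] X \<rho>(1) by (intro finite_sum_le_infsum) (auto simp: abs_conv_def)
      also have "\<dots> \<le> 2 * wnorm \<rho> F"
        using G by simp
      finally show "(\<Sum>p\<in>X. norm (coeff_of H p) * \<rho> ^ mdeg p) \<le> 2 * wnorm \<rho> F" .
    qed
  qed (use \<rho>(1) in auto)
  have fix_H: "F = H + T H"
  proof (rule mfps_eqI)
    fix p :: "nat ^ 'n"
    let ?n = "mdeg p"
    \<comment> \<open>Replacing \<open>H\<close> by \<open>G ?n\<close> changes the value of
      \<open>T\<close> only in degrees above \<open>mdeg p\<close>.\<close>
    have "order_ge ?n (H - G ?n)"
      by (simp add: order_ge_def coeff_simps H)
    then have "coeff_of (T (H - G ?n)) p = 0"
      using T_order[of ?n "H - G ?n"] by (simp add: order_ge_def)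
    moreover have "coeff_of H p = coeff_of (F - T (G ?n)) p"
      using H[of p "Suc ?n"] by (simp add: G_Suc)
    ultimately show "coeff_of F p = coeff_of (H + T H) p"
      by (simp add: T_diff coeff_simps)
  qed
  have "F = (\<Sum>s\<in>S. D s H * b s) + Rm H"
  proof -
    have "F = (\<Sum>s\<in>S. D s H * mfps_monom (r s)) + Rm H + T H"
      using fix_H decomp[of H] by simp
    also have "\<dots> = (\<Sum>s\<in>S. D s H * b s) + Rm H"
      by (simp add: T_def e_def right_diff_distrib sum_subtractf)
    finally show ?thesis .
  qed
  moreover have "coeff_of (Rm H) (q + r s) = 0" if "s \<in> S" for s q
    using that by (auto simp: Rm_def)
  ultimately show ?thesis
    using that[of \<rho> "\<lambda>s. D s H" "Rm H"] \<rho> conv_D[OF \<open>abs_conv \<rho> H\<close>] by blast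
qed

subsection \<open>Initial terms in the ideal generated by the resonant monomials\<close>

lemma finite_mdeg_less: "finite {p :: nat ^ 'n::finite. mdeg p < N}"
proof (rule finite_subset)
  show "{p :: nat ^ 'n. mdeg p < N} \<subseteq> vec_lambda ` (PiE UNIV (\<lambda>_. {..N}))"
  proof
    fix p :: "nat ^ 'n" assume "p \<in> {p. mdeg p < N}"
    then have "p $ k \<le> N" for k
      using component_le_mdeg[of p k] by simp
    then show "p \<in> vec_lambda ` (PiE UNIV (\<lambda>_. {..N}))"
      by (intro image_eqI[of _ _ "\<lambda>k. p $ k"]) auto
  qed
qed (intro finite_imageI finite_PiE; simp)

lemma finite_mdeg_eq: "finite {p :: nat ^ 'n::finite. mdeg p = N}"
  by (rule finite_subset[OF _ finite_mdeg_less[of "Suc N"]]) auto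

definition mfps_pow :: "('n::finite \<Rightarrow> 'n mfps) \<Rightarrow> nat ^ 'n \<Rightarrow> 'n mfps" where
  "mfps_pow h p = (\<Prod>k\<in>UNIV. h k ^ (p $ k))"

lemma mfps_pow_add: "mfps_pow h (p + q) = mfps_pow h p * mfps_pow h q"
  by (simp add: mfps_pow_def power_add prod.distrib)

text \<open>Membership in the closure, in the topology of formal power series, of the span of the
  powers \<open>h^p\<close> with \<open>p\<close> in \<open>M\<close>. For \<open>M\<close> the
  multiples of the \<open>r s\<close> it contains the ideal of the \<open>h^(r s)\<close>. Finite
  sums modulo order \<open>N\<close> avoid infinite expansions in \<open>h\<close>.\<close>

definition approx :: "('n::finite \<Rightarrow> 'n mfps) \<Rightarrow> (nat ^ 'n) set \<Rightarrow> 'n mfps \<Rightarrow> bool" where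
  "approx h M a \<longleftrightarrow> (\<forall>N. \<exists>A c. finite A \<and> A \<subseteq> M \<and>
     order_ge N (a - (\<Sum>p\<in>A. mfps_const (c p) * mfps_pow h p)))"

text \<open>The powers \<open>h^p\<close> with \<open>mdeg p = N\<close> start with the distinct
  monomials \<open>z^p\<close>, so the part of degree \<open>N\<close> of the remainder can be
  removed without disturbing lower degrees.\<close>

lemma approx_UNIV:
  assumes "tangent_to_identity h"
  shows "approx h UNIV a"
  unfolding approx_def
proof
  fix N
  have "\<exists>c. order_ge N (a - (\<Sum>p | mdeg p < N. mfps_const (c p) * mfps_pow h p))"
  proof (induction N)
    case (Suc N)
    then obtain c where c: "order_ge N (a - (\<Sum>p | mdeg p < N. mfps_const (c p) * mfps_pow h p))"
      by blast
    let ?b = "a - (\<Sum>p | mdeg p < N. mfps_const (c p) * mfps_pow h p)"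
    define c' where "c' p = (if mdeg p < N then c p else coeff_of ?b p)" for p
    have "{p :: nat ^ 'a. mdeg p < Suc N} = {p. mdeg p < N} \<union> {p. mdeg p = N}"
      by auto
    then have "(\<Sum>p | mdeg p < Suc N. mfps_const (c' p) * mfps_pow h p) =
        (\<Sum>p | mdeg p < N. mfps_const (c' p) * mfps_pow h p) +
        (\<Sum>p | mdeg p = N. mfps_const (c' p) * mfps_pow h p)"
      using finite_mdeg_less[of N] finite_mdeg_eq[of N]
      by (simp only:) (subst sum.union_disjoint, auto)
    also have "(\<Sum>p | mdeg p < N. mfps_const (c' p) * mfps_pow h p) =
        (\<Sum>p | mdeg p < N. mfps_const (c p) * mfps_pow h p)"
      by (rule sum.cong) (simp_all add: c'_def)
    also have "(\<Sum>p | mdeg p = N. mfps_const (c' p) * mfps_pow h p) =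
        (\<Sum>p | mdeg p = N. mfps_const (coeff_of ?b p) * mfps_pow h p)"
      by (rule sum.cong) (simp_all add: c'_def)
    finally have eq: "a - (\<Sum>p | mdeg p < Suc N. mfps_const (c' p) * mfps_pow h p) =
        ?b - (\<Sum>p | mdeg p = N. mfps_const (coeff_of ?b p) * mfps_pow h p)"
      by (simp add: algebra_simps)
    have "order_ge (Suc N) (?b - (\<Sum>p | mdeg p = N. mfps_const (coeff_of ?b p) * mfps_pow h p))"
      unfolding order_ge_def
    proof (intro allI impI)
      fix q :: "nat ^ 'a" assume q: "mdeg q < Suc N"
      have "coeff_of (mfps_pow h p) q = (if q = p then 1 else 0)" if "mdeg p = N" for p
        using leading_tangent_to_identity[OF assms, of p] q that by (simp add: leading_def mfps_pow_def)
      then have "(\<Sum>p | mdeg p = N. coeff_of ?b p * coeff_of (mfps_pow h p) q) =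
          (\<Sum>p | mdeg p = N. if q = p then coeff_of ?b p else 0)"
        by (intro sum.cong) auto
      also have "\<dots> = (if mdeg q = N then coeff_of ?b q else 0)"
        by (simp add: finite_mdeg_eq)
      also have "\<dots> = coeff_of ?b q"
        using c q by (auto simp: order_ge_def less_Suc_eq)
      finally have "coeff_of (\<Sum>p | mdeg p = N. mfps_const (coeff_of ?b p) * mfps_pow h p) q = coeff_of ?b q"
        by (simp only: coeff_sum coeff_const_mult)
      then show "coeff_of (?b - (\<Sum>p | mdeg p = N. mfps_const (coeff_of ?b p) * mfps_pow h p)) q = 0"
        by (simp add: minus_mfps.rep_eq)
    qed
    then show ?case
      using eq by metis
  qed simp
  then show "\<exists>A c. finite A \<and> A \<subseteq> UNIV \<and> order_ge N (a - (\<Sum>p\<in>A. mfps_const (c p) * mfps_pow h p))"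
    using finite_mdeg_less[of N] by (metis subset_UNIV)
qed

text \<open>Multiplying an approximation of \<open>a\<close> by \<open>h^r\<close> shifts its
  exponents by \<open>r\<close>, hence into \<open>M\<close>, and does not lower the order of the
  error.\<close>

lemma approx_mult:
  assumes "tangent_to_identity h" "\<And>q. q + r \<in> M"
  shows "approx h M (a * mfps_pow h r)"
  unfolding approx_def
proof
  fix N
  obtain A c where A: "finite A" "order_ge N (a - (\<Sum>p\<in>A. mfps_const (c p) * mfps_pow h p))"
    using approx_UNIV[OF assms(1), of a] unfolding approx_def by blast
  have "(\<Sum>p\<in>(\<lambda>p. p + r) ` A. mfps_const (c (p - r)) * mfps_pow h p) =
      (\<Sum>p\<in>A. mfps_const (c p) * mfps_pow h p) * mfps_pow h r"
    by (subst sum.reindex) (auto simp: inj_on_def mfps_pow_add sum_distrib_right mult.assoc)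
  then have "a * mfps_pow h r - (\<Sum>p\<in>(\<lambda>p. p + r) ` A. mfps_const (c (p - r)) * mfps_pow h p) =
      (a - (\<Sum>p\<in>A. mfps_const (c p) * mfps_pow h p)) * mfps_pow h r"
    by (simp add: left_diff_distrib)
  then have "order_ge N (a * mfps_pow h r - (\<Sum>p\<in>(\<lambda>p. p + r) ` A. mfps_const (c (p - r)) * mfps_pow h p))"
    using order_ge_mult[OF A(2) order_ge_0] by simp
  then show "\<exists>A c. finite A \<and> A \<subseteq> M \<and> order_ge N (a * mfps_pow h r - (\<Sum>p\<in>A. mfps_const (c p) * mfps_pow h p))"
    using A(1) assms(2) by (intro exI[of _ "(\<lambda>p. p + r) ` A"] exI[of _ "\<lambda>p. c (p - r)"]) auto
qed

lemma approx_diff: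
  assumes "approx h M a" "approx h M b"
  shows "approx h M (a - b)"
  unfolding approx_def
proof
  fix N
  obtain A c where A: "finite A" "A \<subseteq> M" "order_ge N (a - (\<Sum>p\<in>A. mfps_const (c p) * mfps_pow h p))"
    using assms(1) unfolding approx_def by blast
  obtain B d where B: "finite B" "B \<subseteq> M" "order_ge N (b - (\<Sum>p\<in>B. mfps_const (d p) * mfps_pow h p))"
    using assms(2) unfolding approx_def by blast
  let ?c = "\<lambda>p. (if p \<in> A then c p else 0) - (if p \<in> B then d p else 0)"
  have const_diff: "mfps_const (x - y) * u = mfps_const x * u - mfps_const y * u" for x y and u :: "'a mfps"
    by (rule mfps_eqI) (simp add: coeff_const_mult coeff_simps left_diff_distrib)
  have const_0: "mfps_const 0 * u = 0" for u :: "'a mfps"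
    by (rule mfps_eqI) (simp add: coeff_const_mult coeff_simps)
  have "(\<Sum>p\<in>A \<union> B. mfps_const (?c p) * mfps_pow h p) =
      (\<Sum>p\<in>A \<union> B. mfps_const (if p \<in> A then c p else 0) * mfps_pow h p) -
      (\<Sum>p\<in>A \<union> B. mfps_const (if p \<in> B then d p else 0) * mfps_pow h p)"
    by (simp add: const_diff sum_subtractf)
  also have "(\<Sum>p\<in>A \<union> B. mfps_const (if p \<in> A then c p else 0) * mfps_pow h p) =
      (\<Sum>p\<in>A. mfps_const (c p) * mfps_pow h p)"
    using A B by (intro sum.mono_neutral_cong_right) (auto simp: const_0)
  also have "(\<Sum>p\<in>A \<union> B. mfps_const (if p \<in> B then d p else 0) * mfps_pow h p) =
      (\<Sum>p\<in>B. mfps_const (d p) * mfps_pow h p)"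
    using A B by (intro sum.mono_neutral_cong_right) (auto simp: const_0)
  finally have eq: "a - b - (\<Sum>p\<in>A \<union> B. mfps_const (?c p) * mfps_pow h p) =
      (a - (\<Sum>p\<in>A. mfps_const (c p) * mfps_pow h p)) - (b - (\<Sum>p\<in>B. mfps_const (d p) * mfps_pow h p))"
    by simp
  then have "order_ge N (a - b - (\<Sum>p\<in>A \<union> B. mfps_const (?c p) * mfps_pow h p))"
    using order_ge_diff[OF A(3) B(3)] by (simp only: eq)
  then show "\<exists>A c. finite A \<and> A \<subseteq> M \<and> order_ge N (a - b - (\<Sum>p\<in>A. mfps_const (c p) * mfps_pow h p))"
    using A B by (intro exI[of _ "A \<union> B"] exI[of _ ?c]) auto
qed

lemma approx_diff_sum:
  assumes "approx h M a" "\<And>s. s \<in> S \<Longrightarrow> approx h M (f s)"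
  shows "approx h M (a - sum f S)"
  using assms(2)
proof (induction S rule: infinite_finite_induct)
  case (insert s S)
  then have "approx h M (a - sum f S)" "approx h M (f s)"
    by auto
  then have "approx h M ((a - sum f S) - f s)"
    by (rule approx_diff)
  with insert.hyps show ?case
    by (simp add: diff_diff_eq add.commute)
qed (use assms(1) in simp_all)

text \<open>Since \<open>h^p\<close> has order \<open>mdeg p\<close>, cutting \<open>G\<close> off
  at degree \<open>N\<close> changes the substitution only from order \<open>N\<close> on.\<close>

lemma approx_subst:
  assumes "tangent_to_identity h" "\<And>p. coeff_of G p \<noteq> 0 \<Longrightarrow> p \<in> M"
  shows "approx h M (mfps_subst G h)"
  unfolding approx_def
proof
  fix N
  let ?A = "{p. mdeg p < N \<and> p \<in> M}"
  have fin: "finite ?A"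
    by (rule finite_subset[OF _ finite_mdeg_less[of N]]) auto
  have "order_ge N (mfps_subst G h - (\<Sum>p\<in>?A. mfps_const (coeff_of G p) * mfps_pow h p))"
    unfolding order_ge_def
  proof (intro allI impI)
    fix q :: "nat ^ 'a" assume q: "mdeg q < N"
    have "coeff_of (mfps_subst G h) q = (\<Sum>p | mdeg p \<le> mdeg q. coeff_of G p * coeff_of (mfps_pow h p) q)"
      by (simp add: mfps_subst_def mfps_pow_def)
    also have "\<dots> = (\<Sum>p | mdeg p < N. coeff_of G p * coeff_of (mfps_pow h p) q)"
    proof (rule sum.mono_neutral_left[OF finite_mdeg_less])
      show "\<forall>p\<in>{p. mdeg p < N} - {p. mdeg p \<le> mdeg q}. coeff_of G p * coeff_of (mfps_pow h p) q = 0"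
        using leading_tangent_to_identity[OF assms(1)] by (auto simp: leading_def mfps_pow_def)
    qed (use q in auto)
    also have "\<dots> = (\<Sum>p\<in>?A. coeff_of G p * coeff_of (mfps_pow h p) q)"
      by (rule sum.mono_neutral_right[OF finite_mdeg_less]) (use assms(2) in auto)
    finally show "coeff_of (mfps_subst G h - (\<Sum>p\<in>?A. mfps_const (coeff_of G p) * mfps_pow h p)) q = 0"
      by (simp only: minus_mfps.rep_eq coeff_sum coeff_const_mult) simp
  qed
  then show "\<exists>A c. finite A \<and> A \<subseteq> M \<and>
      order_ge N (mfps_subst G h - (\<Sum>p\<in>A. mfps_const (c p) * mfps_pow h p))"
    using fin by blast
qed

text \<open>The terms of lowest degree of \<open>a\<close> are the monomials of lowest degree of its approximation.\<close>

lemma approx_eq_0: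
  assumes "tangent_to_identity h" "approx h M a" "\<And>p. p \<in> M \<Longrightarrow> coeff_of a p = 0"
  shows "a = 0"
proof (rule mfps_eqI, rule ccontr)
  fix q assume "coeff_of a q \<noteq> coeff_of 0 q"
  then have q: "coeff_of a q \<noteq> 0"
    by (simp add: coeff_simps)
  obtain A c where A: "finite A" "A \<subseteq> M"
    "order_ge (Suc (mdeg q)) (a - (\<Sum>p\<in>A. mfps_const (c p) * mfps_pow h p))"
    using assms(2) unfolding approx_def by blast
  have coeff: "coeff_of a u = (\<Sum>p\<in>A. c p * coeff_of (mfps_pow h p) u)" if "mdeg u \<le> mdeg q" for u
    using A(3) that by (simp add: order_ge_def minus_mfps.rep_eq coeff_sum coeff_const_mult less_Suc_eq_le)
  have lead: "coeff_of (mfps_pow h p) u = (if u = p then 1 else 0)" if "mdeg u \<le> mdeg p" for p u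
    using leading_tangent_to_identity[OF assms(1), of p] that by (simp add: leading_def mfps_pow_def)
  define L where "L = {p \<in> A. c p \<noteq> 0 \<and> mdeg p \<le> mdeg q}"
  have "L \<noteq> {}"
  proof
    assume "L = {}"
    then have "c p * coeff_of (mfps_pow h p) q = 0" if "p \<in> A" for p
      using that lead[of q p] by (cases "c p = 0") (auto simp: L_def)
    then show False
      using q coeff[of q] by (simp add: sum.neutral)
  qed
  \<comment> \<open>Least degree excludes cancellation: every other term with nonzero coefficient
    starts at degree \<open>mdeg u\<close> or above with a monomial different from \<open>u\<close>.
    So the coefficient of \<open>a\<close> at \<open>u\<close> is \<open>c u\<close>, nonzero
    although \<open>u\<close> lies in \<open>M\<close>.\<close>
  then obtain u where u: "u \<in> L" "\<And>p. p \<in> L \<Longrightarrow> mdeg u \<le> mdeg p"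
    using arg_min_if_finite[of L mdeg] A(1) arg_min_least[of L _ mdeg] by (auto simp: L_def)
  have "coeff_of a u = (\<Sum>p\<in>A. c p * coeff_of (mfps_pow h p) u)"
    using u(1) by (intro coeff) (auto simp: L_def)
  also have "\<dots> = (\<Sum>p\<in>A. if p = u then c u else 0)"
  proof (rule sum.cong)
    fix p assume p: "p \<in> A"
    show "c p * coeff_of (mfps_pow h p) u = (if p = u then c u else 0)"
    proof (cases "c p = 0")
      case False
      then have "mdeg u \<le> mdeg p"
        using u p by (cases "p \<in> L") (auto simp: L_def)
      then show ?thesis using lead by auto
    qed auto
  qed simp
  also have "\<dots> = c u"
    using A(1) u(1) by (simp add: L_def)
  finally show False
    using assms(3) A(2) u(1) by (auto simp: L_def)
qed

subsection \<open>Invariance of the resonant variety\<close>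

text \<open>Gronwall's argument in complex time: on a small disc of radius \<open>e\<close> around a
  zero, the mean value inequality bounds the maximum of \<open>g\<close> by \<open>C * e < 1\<close>
  times itself. So the zero set is open as well as closed in the connected set
  \<open>D\<close>.\<close>

lemma linear_differential_inequality_zero:
  fixes u :: "'s \<Rightarrow> complex \<Rightarrow> complex"
  assumes D: "open D" "connected D" and S: "finite S"
    and deriv: "\<And>s \<tau>. s \<in> S \<Longrightarrow> \<tau> \<in> D \<Longrightarrow> (u s has_field_derivative u' s \<tau>) (at \<tau>)"
    and bound: "\<And>s \<tau>. s \<in> S \<Longrightarrow> \<tau> \<in> D \<Longrightarrow> norm (u' s \<tau>) \<le> B * (\<Sum>i\<in>S. norm (u i \<tau>))"
    and zero: "\<tau>0 \<in> D" "\<And>s. s \<in> S \<Longrightarrow> u s \<tau>0 = 0"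
    and \<tau>: "\<tau> \<in> D" "s \<in> S"
  shows "u s \<tau> = 0"
proof -
  define g where "g \<sigma> = (\<Sum>i\<in>S. norm (u i \<sigma>))" for \<sigma>
  have cont: "continuous_on D (u i)" if "i \<in> S" for i
    using DERIV_isCont[OF deriv[OF that]] by (simp add: continuous_at_imp_continuous_on)
  then have cont_g: "continuous_on D g"
    unfolding g_def by (intro continuous_intros)
  define Z where "Z = {\<sigma> \<in> D. g \<sigma> = 0}"
  have "\<exists>e>0. ball \<sigma> e \<subseteq> Z" if "\<sigma> \<in> Z" for \<sigma>
  proof -
    have "\<sigma> \<in> D" using that by (simp add: Z_def)
    then obtain e0 where e0: "e0 > 0" "cball \<sigma> e0 \<subseteq> D"
      using open_contains_cball_eq[OF D(1)] by blast
    \<comment> \<open>\<open>B\<close> carries no sign assumption, hence the \<open>max\<close>;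
      \<open>card S\<close> comes from summing the bound over the components.\<close>
    define C where "C = max B 0 * real (card S)"
    define e where "e = min e0 (1 / (2 * (C + 1)))"
    have C: "C \<ge> 0" by (simp add: C_def)
    then have e: "e > 0" "cball \<sigma> e \<subseteq> D" "C * e < 1"
    proof -
      show "e > 0" using C e0 by (simp add: e_def)
      show "cball \<sigma> e \<subseteq> D" using e0 by (auto simp: e_def)
      have "C * e \<le> C * (1 / (2 * (C + 1)))"
        using C by (intro mult_left_mono) (auto simp: e_def)
      also have "\<dots> < 1" using C by (simp add: field_simps)
      finally show "C * e < 1" .
    qed
    obtain \<xi> where \<xi>: "\<xi> \<in> cball \<sigma> e" "\<And>\<eta>. \<eta> \<in> cball \<sigma> e \<Longrightarrow> g \<eta> \<le> g \<xi>"
      using continuous_attains_sup[of "cball \<sigma> e" g] e continuous_on_subset[OF cont_g e(2)] by auto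
    have g_nonneg: "g \<eta> \<ge> 0" for \<eta>
      unfolding g_def by (simp add: sum_nonneg)
    have "norm (u i \<xi>) \<le> max B 0 * g \<xi> * e" if i: "i \<in> S" for i
    proof -
      have "norm (u i \<xi> - u i \<sigma>) \<le> max B 0 * g \<xi> * norm (\<xi> - \<sigma>)"
      proof (rule field_differentiable_bound[OF convex_cball])
        fix \<eta> assume \<eta>: "\<eta> \<in> cball \<sigma> e"
        with e(2) have "\<eta> \<in> D" by blast
        then show "(u i has_field_derivative u' i \<eta>) (at \<eta> within cball \<sigma> e)"
          by (rule has_field_derivative_at_within[OF deriv[OF i]])
        have "norm (u' i \<eta>) \<le> B * g \<eta>"
          using bound[OF i] \<eta> e(2) by (auto simp: g_def)
        also have "\<dots> \<le> max B 0 * g \<xi>"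
          using \<xi>(2)[OF \<eta>] g_nonneg by (intro mult_mono) auto
        finally show "norm (u' i \<eta>) \<le> max B 0 * g \<xi>" .
      qed (use \<xi>(1) e(1) in auto)
      moreover have "u i \<sigma> = 0"
        using \<open>\<sigma> \<in> Z\<close> i S by (auto simp: Z_def g_def sum_nonneg_eq_0_iff)
      moreover have "max B 0 * g \<xi> * norm (\<xi> - \<sigma>) \<le> max B 0 * g \<xi> * e"
        using \<xi>(1) g_nonneg by (intro mult_left_mono) (auto simp: dist_norm norm_minus_commute)
      ultimately show ?thesis by simp
    qed
    then have "g \<xi> \<le> (\<Sum>i\<in>S. max B 0 * g \<xi> * e)"
      unfolding g_def[of \<xi>] by (intro sum_mono) (simp add: g_def)
    also have "\<dots> = (C * e) * g \<xi>"
      by (simp add: C_def mult_ac)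
    finally have "g \<xi> \<le> (C * e) * g \<xi>" .
    then have "(1 - C * e) * g \<xi> \<le> 0"
      by (simp add: algebra_simps)
    then have "g \<xi> = 0"
      using e(3) g_nonneg[of \<xi>] by (simp add: mult_le_0_iff)
    then have "ball \<sigma> e \<subseteq> Z"
      using \<xi>(2) g_nonneg e(2) by (force simp: Z_def intro: antisym)
    then show ?thesis using e(1) by blast
  qed
  then have "open Z"
    unfolding open_contains_ball by blast
  then have "openin (top_of_set D) Z"
    by (rule open_openin_trans[OF D(1)]) (auto simp: Z_def)
  moreover have "closedin (top_of_set D) Z"
    using continuous_closedin_preimage_constant[OF cont_g, of 0] by (simp add: Z_def)
  moreover have "\<tau>0 \<in> Z"
    using zero by (simp add: Z_def g_def)
  ultimately have "Z = D"
    using D(2) unfolding connected_clopen by blast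
  then show ?thesis
    using \<tau> S by (auto simp: Z_def g_def sum_nonneg_eq_0_iff)
qed

lemma mfps_subst_add: "mfps_subst (a + b) h = mfps_subst a h + mfps_subst b h"
  by (rule mfps_eqI) (simp add: mfps_subst_def coeff_simps distrib_right sum.distrib)

text \<open>At \<open>q = 0\<close> the truncation in \<open>mfps_subst\<close> omits the linear
  term; the value is still right because \<open>h i\<close> has no constant term.\<close>

lemma mfps_subst_linear:
  assumes "coeff_of (h i) 0 = 0"
  shows "mfps_subst (mfps_const c * mfps_var i) h = mfps_const c * h i"
proof (rule mfps_eqI)
  fix q :: "nat ^ 'a"
  have pow: "(\<Prod>k\<in>UNIV. h k ^ (axis i 1 $ k)) = h i"
  proof -
    have "(\<Prod>k\<in>UNIV. h k ^ (axis i 1 $ k)) = (\<Prod>k\<in>UNIV. if k = i then h k else 1)"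
      by (rule prod.cong) (auto simp: axis_def)
    then show ?thesis by simp
  qed
  have fin: "finite {p :: nat ^ 'a. mdeg p \<le> mdeg q}"
    using finite_mdeg_less[of "Suc (mdeg q)"] by (simp add: less_Suc_eq_le)
  have "coeff_of (mfps_subst (mfps_const c * mfps_var i) h) q =
      (\<Sum>p | mdeg p \<le> mdeg q. if p = axis i 1 then c * coeff_of (h i) q else 0)"
    unfolding mfps_subst_def coeff_Abs
    by (rule sum.cong) (auto simp: coeff_const_mult mfps_var_def coeff_simps pow[simplified])
  also have "\<dots> = (if 1 \<le> mdeg q then c * coeff_of (h i) q else 0)"
    using fin by simp
  also have "\<dots> = coeff_of (mfps_const c * h i) q"
  proof (cases "mdeg q = 0")
    case True
    then have "q = 0" by (simp add: mdeg_eq_0_iff)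
    then show ?thesis using assms by (simp add: coeff_const_mult)
  qed (simp add: coeff_const_mult)
  finally show "coeff_of (mfps_subst (mfps_const c * mfps_var i) h) q = coeff_of (mfps_const c * h i) q" .
qed

text \<open>
  The quotients of the formal normal form need not converge; dividing again by the powers
  \<open>mfps_pow h (r s)\<close> gives convergent quotients for the components of the transformed field.
\<close>

lemma convergent_quotients:
  assumes norm: "formal_normalization lam l r X h"
    and conv: "\<And>k. abs_conv \<rho>0 (h k)" "\<And>k. abs_conv \<rho>0 (mfps_deriv k (h i))"
      "\<And>k. abs_conv \<rho>0 (X k)" "\<rho>0 > 0"
  obtains \<rho> c where "\<rho> > 0" "\<rho> \<le> \<rho>0" "\<And>s. s \<in> {1..l} \<Longrightarrow> abs_conv \<rho> (c s)"
    "(\<Sum>k\<in>UNIV. mfps_deriv k (h i) * X k) = mfps_const (lam $ i) * h i + (\<Sum>s=1..l. c s * mfps_pow h (r s))"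
proof -
  obtain g where tang: "tangent_to_identity h"
    and conj: "conjugates h X (\<lambda>i. mfps_const (lam $ i) * mfps_var i + (\<Sum>s=1..l. g i s * mfps_monom (r s)))"
    using norm unfolding formal_normalization_def by blast
  define M where "M = {p. \<exists>s\<in>{1..l}. \<exists>q. p = q + r s}"
  define F where "F = (\<Sum>k\<in>UNIV. mfps_deriv k (h i) * X k) - mfps_const (lam $ i) * h i"
  let ?G = "\<Sum>s=1..l. g i s * mfps_monom (r s)"
  have "(\<Sum>k\<in>UNIV. mfps_deriv k (h i) * X k) = mfps_subst (mfps_const (lam $ i) * mfps_var i + ?G) h"
    using conj unfolding conjugates_def by blast
  also have "\<dots> = mfps_const (lam $ i) * h i + mfps_subst ?G h"
    using tang by (simp add: mfps_subst_add mfps_subst_linear tangent_to_identity_def)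
  finally have F: "F = mfps_subst ?G h"
    by (simp add: F_def)
  have "p \<in> M" if "coeff_of ?G p \<noteq> 0" for p
  proof -
    obtain s where "s \<in> {1..l}" "coeff_of (g i s * mfps_monom (r s)) p \<noteq> 0"
      using \<open>coeff_of ?G p \<noteq> 0\<close> unfolding coeff_sum by (meson sum.neutral)
    then show ?thesis
      unfolding M_def using coeff_mult_monom_eq_0 by blast
  qed
  then have approx_F: "approx h M F"
    unfolding F by (rule approx_subst[OF tang])
  have conv_F: "abs_conv \<rho>0 F"
    unfolding F_def using conv
    by (intro abs_conv_diff abs_conv_mult abs_conv_sum[THEN conjunct1]) auto
  have "leading (mfps_pow h (r s)) (r s)" "abs_conv \<rho>0 (mfps_pow h (r s))" for s
    using leading_tangent_to_identity[OF tang] conv unfolding mfps_pow_def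
    by (auto intro!: abs_conv_prod abs_conv_power)
  then obtain \<rho> c R where \<rho>: "\<rho> > 0" "\<rho> \<le> \<rho>0" "\<And>s. s \<in> {1..l} \<Longrightarrow> abs_conv \<rho> (c s)"
    and FR: "F = (\<Sum>s=1..l. c s * mfps_pow h (r s)) + R"
    and R: "\<And>s q. s \<in> {1..l} \<Longrightarrow> coeff_of R (q + r s) = 0"
    using convergent_division[of "{1..l}" "\<lambda>s. mfps_pow h (r s)" r \<rho>0 F] conv_F conv(4) by blast
  \<comment> \<open>\<open>F\<close> and the products \<open>c s * mfps_pow h (r s)\<close> are
    approximable over \<open>M\<close>, hence so is \<open>R\<close>; having no monomial in
    \<open>M\<close>, it must vanish.\<close>
  have "approx h M (F - (\<Sum>s=1..l. c s * mfps_pow h (r s)))"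
    using approx_F by (rule approx_diff_sum) (auto simp: M_def intro!: approx_mult[OF tang])
  then have "approx h M R"
    by (simp add: FR)
  then have "R = 0"
    by (rule approx_eq_0[OF tang]) (auto simp: M_def R)
  then show ?thesis
    using that[of \<rho> c] \<rho> FR by (simp add: F_def algebra_simps)
qed

lemma map_converges_common_radius:
  assumes "map_converges h"
  obtains \<rho> where "\<rho> > 0" "\<And>k. abs_conv \<rho> (h k)"
proof -
  have "\<forall>k. \<exists>\<rho>>0. abs_conv \<rho> (h k)"
    using assms by (simp add: map_converges_def mfps_converges_iff)
  then obtain R where R: "\<And>k. R k > 0" "\<And>k. abs_conv (R k) (h k)"
    by metis
  define \<rho> where "\<rho> = Min (range R)"
  have "\<rho> > 0"
    using R(1) by (simp add: \<rho>_def)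
  moreover have "abs_conv \<rho> (h k)" for k
    by (rule abs_conv_shrink[OF R(2)[of k]]) (use R(1)[of k] \<open>\<rho> > 0\<close> in \<open>auto simp: \<rho>_def less_imp_le[OF R(1)]\<close>)
  ultimately show ?thesis by (rule that)
qed

theorem locally_invariant_resonant_variety:
  fixes X h :: "'n::finite \<Rightarrow> 'n mfps"
  assumes norm: "formal_normalization lam l r X h" and conv: "map_converges h" "map_converges X"
  shows "locally_invariant (map_eval X) {z. \<forall>s\<in>{1..l}. mpower (map_eval h z) (r s) = 0}"
proof -
  obtain \<rho>h where \<rho>h: "\<rho>h > 0" "\<And>k. abs_conv \<rho>h (h k)"
    using map_converges_common_radius[OF conv(1)] by blast
  obtain \<rho>X where \<rho>X: "\<rho>X > 0" "\<And>k. abs_conv \<rho>X (X k)"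
    using map_converges_common_radius[OF conv(2)] by blast
  \<comment> \<open>The half leaves room for the derivatives of \<open>h\<close>.\<close>
  define \<rho>0 where "\<rho>0 = min (\<rho>h / 2) \<rho>X"
  have \<rho>0: "\<rho>0 > 0" "\<And>k. abs_conv \<rho>0 (h k)" "\<And>k i. abs_conv \<rho>0 (mfps_deriv k (h i))" "\<And>k. abs_conv \<rho>0 (X k)"
  proof -
    show pos: "\<rho>0 > 0" using \<rho>h(1) \<rho>X(1) by (simp add: \<rho>0_def)
    have le: "\<rho>0 \<le> \<rho>h / 2" "\<rho>0 \<le> \<rho>X"
      by (simp_all add: \<rho>0_def)
    show "abs_conv \<rho>0 (h k)" for k
      by (rule abs_conv_shrink[OF \<rho>h(2)]) (use pos le \<rho>h(1) in simp_all)
    show "abs_conv \<rho>0 (X k)" for k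
      by (rule abs_conv_shrink[OF \<rho>X(2)]) (use pos le \<rho>X(1) in simp_all)
    show "abs_conv \<rho>0 (mfps_deriv k (h i))" for k i
    proof (rule abs_conv_shrink)
      show "abs_conv (\<rho>h / 2) (mfps_deriv k (h i))"
        using \<rho>h(2)[of i] \<rho>h(1) by (rule abs_conv_deriv)
      show "\<rho>0 \<ge> 0" "\<rho>0 \<le> \<rho>h / 2" "\<rho>h / 2 > 0"
        using pos le(1) \<rho>h(1) by linarith+
    qed
  qed
  define good where "good i \<rho> c \<longleftrightarrow> \<rho> > 0 \<and> \<rho> \<le> \<rho>0 \<and> (\<forall>s\<in>{1..l}. abs_conv \<rho> (c s)) \<and>
    (\<Sum>k\<in>UNIV. mfps_deriv k (h i) * X k) = mfps_const (lam $ i) * h i + (\<Sum>s=1..l. c s * mfps_pow h (r s))"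
    for i \<rho> c
  have "\<exists>\<rho> c. good i \<rho> c" for i
    unfolding good_def by (rule convergent_quotients[OF norm \<rho>0(2) \<rho>0(3) \<rho>0(4) \<rho>0(1), of i]) blast
  then obtain Q c where "\<And>i. good i (Q i) (c i)"
    by metis
  then have Q: "\<And>i. Q i > 0" "\<And>i. Q i \<le> \<rho>0" "\<And>i s. s \<in> {1..l} \<Longrightarrow> abs_conv (Q i) (c i s)"
    and field: "\<And>i. (\<Sum>k\<in>UNIV. mfps_deriv k (h i) * X k) =
      mfps_const (lam $ i) * h i + (\<Sum>s=1..l. c i s * mfps_pow h (r s))"
    unfolding good_def by blast+
  have tang: "tangent_to_identity h"
    using norm by (simp add: formal_normalization_def)
  define W where "W = (\<Sum>k\<in>UNIV. wnorm \<rho>0 (h k))"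
  have W: "W \<ge> 0" "\<And>k. wnorm \<rho>0 (h k) \<le> W"
    using wnorm_nonneg[of \<rho>0] \<rho>0(1) unfolding W_def by (auto intro!: sum_nonneg member_le_sum)
  \<comment> \<open>Two constraints: all quotients converge, and \<open>wnorm \<rho> (h k)\<close>
    is at most 1, so that all powers of the components of \<open>w\<close> are bounded by 1.\<close>
  define \<rho> where "\<rho> = min (Min (range Q)) (\<rho>0 / (W + 1))"
  have \<rho>: "\<rho> > 0" "\<And>i. \<rho> \<le> Q i" "\<rho> \<le> \<rho>0 / (W + 1)" "\<rho> \<le> \<rho>0"
  proof -
    show "\<rho> > 0" "\<rho> \<le> \<rho>0 / (W + 1)" "\<And>i. \<rho> \<le> Q i"
      using Q(1) \<rho>0(1) W(1) by (auto simp: \<rho>_def min_le_iff_disj)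
    then show "\<rho> \<le> \<rho>0"
      using Q(2) order_trans by blast
  qed
  have shrink: "abs_conv \<rho> a" if "abs_conv \<rho>0 a" for a :: "'n mfps"
    by (rule abs_conv_shrink[OF that]) (use \<rho>(1,4) \<rho>0(1) in simp_all)
  note conv\<rho> = shrink[OF \<rho>0(2)] shrink[OF \<rho>0(3)] shrink[OF \<rho>0(4)]
  have conv_c: "abs_conv \<rho> (c i s)" if "s \<in> {1..l}" for i s
    by (rule abs_conv_shrink[OF Q(3)[OF that]]) (use \<rho>(1,2) Q(1) in \<open>simp_all add: less_imp_le\<close>)
  have wnorm_h: "wnorm \<rho> (h k) \<le> 1" for k
  proof -
    have ord: "order_ge 1 (h k)"
      using tang by (auto simp: order_ge_def mdeg_eq_0_iff tangent_to_identity_def)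
    have "wnorm \<rho> (h k) \<le> (\<rho> / \<rho>0) ^ 1 * wnorm \<rho>0 (h k)"
      by (rule wnorm_shrink(2)[OF \<rho>0(2) _ \<rho>(4) \<rho>0(1) ord]) (use \<rho>(1) in simp)
    also have "\<dots> \<le> (1 / (W + 1)) * W"
    proof (rule mult_mono)
      have "\<rho> / \<rho>0 \<le> (\<rho>0 / (W + 1)) / \<rho>0"
        using \<rho>(3) \<rho>0(1) by (rule divide_right_mono[OF _ less_imp_le])
      then show "(\<rho> / \<rho>0) ^ 1 \<le> 1 / (W + 1)"
        using \<rho>0(1) by simp
      show "wnorm \<rho>0 (h k) \<le> W" by (rule W(2))
      show "wnorm \<rho>0 (h k) \<ge> 0" by (rule wnorm_nonneg[OF less_imp_le[OF \<rho>0(1)]])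
      show "1 / (W + 1) \<ge> 0" using W(1) by simp
    qed
    also have "\<dots> \<le> 1"
      using W(1) by simp
    finally show ?thesis .
  qed
  define C where "C = (\<Sum>i\<in>UNIV. \<Sum>s=1..l. wnorm \<rho> (c i s))"
  have C: "wnorm \<rho> (c i s) \<le> C" if "s \<in> {1..l}" for i s
  proof -
    have "wnorm \<rho> (c i s) \<le> (\<Sum>s=1..l. wnorm \<rho> (c i s))"
      using that by (intro member_le_sum wnorm_nonneg less_imp_le[OF \<rho>(1)]) auto
    also have "\<dots> \<le> C"
      unfolding C_def
      by (intro member_le_sum[of _ _ "\<lambda>i. \<Sum>s=1..l. wnorm \<rho> (c i s)"] sum_nonneg
          wnorm_nonneg less_imp_le[OF \<rho>(1)]) auto
    finally show ?thesis .
  qed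
  define U where "U = ball (0 :: complex ^ 'n) (\<rho> / 2)"
  have U: "norm (z $ k) \<le> \<rho> / 2" "norm (z $ k) \<le> \<rho>" if "z \<in> U" for z k
    using that Finite_Cartesian_Product.norm_nth_le[of z k] \<rho>(1) by (auto simp: U_def)
  let ?S = "{z. \<forall>s\<in>{1..l}. mpower (map_eval h z) (r s) = 0}"
  have "\<gamma> ` D \<subseteq> ?S"
    if D: "open D" "connected D" "\<gamma> ` D \<subseteq> U" and \<tau>0: "\<tau>0 \<in> D" "\<gamma> \<tau>0 \<in> ?S"
      and ode: "\<And>\<tau> j. \<tau> \<in> D \<Longrightarrow> ((\<lambda>\<sigma>. \<gamma> \<sigma> $ j) has_field_derivative map_eval X (\<gamma> \<tau>) $ j) (at \<tau>)"
    for D \<gamma> \<tau>0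
  proof -
    define w where "w j \<tau> = mfps_eval (h j) (\<gamma> \<tau>)" for j \<tau>
    define u where "u s \<tau> = (\<Prod>j\<in>UNIV. w j \<tau> ^ (r s $ j))" for s \<tau>
    define E where "E j \<tau> = (\<Sum>s=1..l. mfps_eval (c j s) (\<gamma> \<tau>) * u s \<tau>)" for j \<tau>
    have \<gamma>U: "\<gamma> \<tau> \<in> U" if "\<tau> \<in> D" for \<tau>
      using D(3) that by auto
    have eval_pow: "mfps_eval (mfps_pow h (r s)) (\<gamma> \<tau>) = u s \<tau>" if "\<tau> \<in> D" for s \<tau>
      unfolding mfps_pow_def u_def w_def using U(2)[OF \<gamma>U[OF that]] conv\<rho> \<rho>(1)
      by (subst eval_prod[of _ \<rho>]) (auto intro!: abs_conv_power prod.cong eval_power)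
    have conv_pow: "abs_conv \<rho> (mfps_pow h (r s))" for s
      unfolding mfps_pow_def using conv\<rho> \<rho>(1) by (auto intro!: abs_conv_prod abs_conv_power)
    have w_deriv: "(w j has_field_derivative lam $ j * w j \<tau> + E j \<tau>) (at \<tau>)" if \<tau>: "\<tau> \<in> D" for j \<tau>
    proof -
      note z = U(2)[OF \<gamma>U[OF \<tau>]]
      have "(w j has_field_derivative (\<Sum>k\<in>UNIV. mfps_eval (mfps_deriv k (h j)) (\<gamma> \<tau>) * map_eval X (\<gamma> \<tau>) $ k)) (at \<tau>)"
        unfolding w_def
        by (rule eval_chain_rule[OF conv\<rho>(1) \<rho>(1) D(1) \<tau> ode]) (use U(1) \<gamma>U in auto)
      also have "(\<Sum>k\<in>UNIV. mfps_eval (mfps_deriv k (h j)) (\<gamma> \<tau>) * map_eval X (\<gamma> \<tau>) $ k) =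
          mfps_eval (\<Sum>k\<in>UNIV. mfps_deriv k (h j) * X k) (\<gamma> \<tau>)"
        using z conv\<rho> \<rho>(1) by (subst eval_sum[of _ \<rho>])
          (auto simp: map_eval_def eval_mult[of \<rho>] intro!: abs_conv_mult)
      also have "\<dots> = lam $ j * w j \<tau> + E j \<tau>"
      proof -
        have c: "abs_conv \<rho> (c j s * mfps_pow h (r s))" if "s \<in> {1..l}" for s
          by (rule abs_conv_mult(1)[OF conv_c[OF that] conv_pow less_imp_le[OF \<rho>(1)]])
        have eval_c: "mfps_eval (c j s * mfps_pow h (r s)) (\<gamma> \<tau>) = mfps_eval (c j s) (\<gamma> \<tau>) * u s \<tau>"
          if "s \<in> {1..l}" for s
          using eval_mult[OF conv_c[OF that] conv_pow z] by (simp only: eval_pow[OF \<tau>])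
        have "mfps_eval (\<Sum>s=1..l. c j s * mfps_pow h (r s)) (\<gamma> \<tau>) =
            (\<Sum>s=1..l. mfps_eval (c j s * mfps_pow h (r s)) (\<gamma> \<tau>))"
          using c z less_imp_le[OF \<rho>(1)] by (rule eval_sum)
        also have "\<dots> = E j \<tau>"
          unfolding E_def by (rule sum.cong[OF refl eval_c])
        finally have eval_E: "mfps_eval (\<Sum>s=1..l. c j s * mfps_pow h (r s)) (\<gamma> \<tau>) = E j \<tau>" .
        have "mfps_eval (mfps_const (lam $ j) * h j) (\<gamma> \<tau>) = lam $ j * w j \<tau>"
          using eval_mult[OF abs_conv_simps(3) conv\<rho>(1) z] by (simp add: eval_const w_def)
        moreover have "abs_conv \<rho> (mfps_const (lam $ j) * h j)"
          by (rule abs_conv_mult(1)[OF abs_conv_simps(3) conv\<rho>(1) less_imp_le[OF \<rho>(1)]])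
        moreover have "abs_conv \<rho> (\<Sum>s=1..l. c j s * mfps_pow h (r s))"
          by (rule conjunct1[OF abs_conv_sum]) (rule c, assumption, rule less_imp_le[OF \<rho>(1)])
        ultimately show ?thesis
          unfolding field by (subst eval_add[OF _ _ z]) (simp_all only: eval_E)
      qed
      finally show ?thesis .
    qed
    define u' where "u' s \<tau> = (\<Sum>j\<in>UNIV. of_nat (r s $ j) * w j \<tau> ^ (r s $ j - 1) * (lam $ j * w j \<tau> + E j \<tau>) *
        (\<Prod>i\<in>UNIV - {j}. w i \<tau> ^ (r s $ i)))" for s \<tau>
    define V where "V \<tau> = (\<Sum>s=1..l. norm (u s \<tau>))" for \<tau>
    \<comment> \<open>The norm of \<open>lam $ j\<close> accounts for the linear part and
      \<open>C\<close> for the quotients; summing over \<open>s\<close> gives one constant for all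
      components.\<close>
    define B where "B = (\<Sum>s=1..l. \<Sum>j\<in>UNIV. real (r s $ j) * (norm (lam $ j) + C))"
    have u_deriv: "(u s has_field_derivative u' s \<tau>) (at \<tau>)" if "\<tau> \<in> D" for s \<tau>
    proof -
      have "((\<lambda>\<tau>. w j \<tau> ^ (r s $ j)) has_field_derivative
          of_nat (r s $ j) * w j \<tau> ^ (r s $ j - 1) * (lam $ j * w j \<tau> + E j \<tau>)) (at \<tau>)" for j
        using w_deriv[OF that, of j] by (auto intro!: derivative_eq_intros)
      from has_field_derivative_prod[of UNIV "\<lambda>j \<tau>. w j \<tau> ^ (r s $ j)", OF this]
      show ?thesis
        by (simp add: u_def[abs_def] u'_def)
    qed
    have u'_bound: "norm (u' s \<tau>) \<le> B * V \<tau>" if \<tau>: "\<tau> \<in> D" and s: "s \<in> {1..l}" for s \<tau>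
    proof -
      note z = U(2)[OF \<gamma>U[OF \<tau>]]
      have V0: "V \<tau> \<ge> 0"
        by (simp add: V_def sum_nonneg)
      have C0: "C \<ge> 0"
        unfolding C_def using \<rho>(1) by (auto intro!: sum_nonneg wnorm_nonneg)
      have u_le: "norm (u s \<tau>) \<le> V \<tau>"
        unfolding V_def using s by (intro member_le_sum) auto
      have w_le: "norm (w j \<tau>) \<le> 1" for j
        unfolding w_def using norm_eval_le[OF conv\<rho>(1) z] wnorm_h[of j] by (meson order_trans)
      have E_le: "norm (E j \<tau>) \<le> C * V \<tau>" for j
      proof -
        have "norm (E j \<tau>) \<le> (\<Sum>s=1..l. norm (mfps_eval (c j s) (\<gamma> \<tau>)) * norm (u s \<tau>))"
          unfolding E_def by (rule order_trans[OF norm_sum]) (simp add: norm_mult)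
        also have "\<dots> \<le> (\<Sum>s=1..l. C * norm (u s \<tau>))"
          by (intro sum_mono mult_right_mono order_trans[OF norm_eval_le[OF conv_c z] C] norm_ge_zero)
        finally show ?thesis
          by (simp add: V_def sum_distrib_left)
      qed
      \<comment> \<open>The linear part restores the missing factor \<open>w j\<close> and gives
        \<open>lam $ j * u s \<tau>\<close>; the rest is \<open>E j \<tau>\<close> with a cofactor
        bounded by 1. If \<open>r s $ j = 0\<close>, the summand is zero.\<close>
      have summand: "norm (of_nat (r s $ j) * w j \<tau> ^ (r s $ j - 1) * (lam $ j * w j \<tau> + E j \<tau>) *
        (\<Prod>i\<in>UNIV - {j}. w i \<tau> ^ (r s $ i))) \<le> (real (r s $ j) * (norm (lam $ j) + C)) * V \<tau>" for j
      proof (cases "r s $ j")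
        case (Suc n)
        let ?P = "\<Prod>i\<in>UNIV - {j}. w i \<tau> ^ (r s $ i)"
        have u_eq: "u s \<tau> = w j \<tau> ^ Suc n * ?P"
          unfolding u_def Suc[symmetric] by (rule prod.remove) simp_all
        have P_le: "norm ?P \<le> 1"
          unfolding prod_norm[symmetric] norm_power
          by (intro prod_le_1 conjI zero_le_power norm_ge_zero power_le_one w_le)
        have "norm (w j \<tau> ^ n * E j \<tau> * ?P) \<le> 1 * (C * V \<tau>) * 1"
          unfolding norm_mult norm_power
          by (intro mult_mono power_le_one E_le P_le w_le norm_ge_zero mult_nonneg_nonneg V0 C0
              zero_le_power zero_le_one)
        moreover have "norm (lam $ j * u s \<tau>) \<le> norm (lam $ j) * V \<tau>"
          using u_le by (simp add: norm_mult mult_left_mono)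
        moreover have "w j \<tau> ^ n * (lam $ j * w j \<tau> + E j \<tau>) * ?P = lam $ j * u s \<tau> + w j \<tau> ^ n * E j \<tau> * ?P"
          unfolding u_eq by (simp add: algebra_simps)
        ultimately have "norm (w j \<tau> ^ n * (lam $ j * w j \<tau> + E j \<tau>) * ?P) \<le> (norm (lam $ j) + C) * V \<tau>"
          using norm_triangle_ineq[of "lam $ j * u s \<tau>" "w j \<tau> ^ n * E j \<tau> * ?P"] by (simp add: distrib_right)
        then have "real (Suc n) * norm (w j \<tau> ^ n * (lam $ j * w j \<tau> + E j \<tau>) * ?P)
            \<le> real (Suc n) * ((norm (lam $ j) + C) * V \<tau>)"
          by (intro mult_left_mono) auto
        moreover have "norm (of_nat (r s $ j) * w j \<tau> ^ (r s $ j - 1) * (lam $ j * w j \<tau> + E j \<tau>) * ?P) =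
            real (Suc n) * norm (w j \<tau> ^ n * (lam $ j * w j \<tau> + E j \<tau>) * ?P)"
          unfolding Suc norm_mult norm_of_nat by (simp only: diff_Suc_1 mult.assoc)
        ultimately show ?thesis
          unfolding Suc by (simp only: mult.assoc)
      qed simp
      have "norm (u' s \<tau>) \<le> (\<Sum>j\<in>UNIV. (real (r s $ j) * (norm (lam $ j) + C)) * V \<tau>)"
        unfolding u'_def by (rule order_trans[OF norm_sum]) (intro sum_mono summand)
      also have "\<dots> = (\<Sum>j\<in>UNIV. real (r s $ j) * (norm (lam $ j) + C)) * V \<tau>"
        by (simp add: sum_distrib_right)
      also have "\<dots> \<le> B * V \<tau>"
        unfolding B_def using V0 s C0
        by (intro mult_right_mono member_le_sum[of _ _ "\<lambda>s. \<Sum>j\<in>UNIV. real (r s $ j) * (norm (lam $ j) + C)"])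
          (auto intro!: sum_nonneg)
      finally show ?thesis .
    qed
    have S_iff: "\<gamma> \<tau> \<in> ?S \<longleftrightarrow> (\<forall>s\<in>{1..l}. u s \<tau> = 0)" for \<tau>
      by (simp add: mpower_def map_eval_def u_def w_def)
    have "u s \<tau> = 0" if "\<tau> \<in> D" "s \<in> {1..l}" for s \<tau>
      by (rule linear_differential_inequality_zero[OF D(1,2), of "{1..l}" u u' B \<tau>0])
        (use u_deriv u'_bound \<tau>0 S_iff that in \<open>auto simp: V_def\<close>)
    then show ?thesis
      using S_iff by blast
  qed
  moreover have "open U" "0 \<in> U"
    using \<rho>(1) by (auto simp: U_def)
  ultimately show ?thesis
    unfolding locally_invariant_def by (intro exI[of _ U]) blast
qed

subsection \<open>The dichotomy\<close>

lemma mfps_converges_add: "mfps_converges a \<Longrightarrow> mfps_converges b \<Longrightarrow> mfps_converges (a + b)"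
  and mfps_converges_mult: "mfps_converges a \<Longrightarrow> mfps_converges b \<Longrightarrow> mfps_converges (a * b)"
proof -
  have "mfps_converges (a + b) \<and> mfps_converges (a * b)" if "mfps_converges a" "mfps_converges b"
  proof -
    obtain \<rho> \<sigma> where \<rho>: "\<rho> > 0" "abs_conv \<rho> a" and \<sigma>: "\<sigma> > 0" "abs_conv \<sigma> b"
      using \<open>mfps_converges a\<close> \<open>mfps_converges b\<close> unfolding mfps_converges_iff by blast
    define e where "e = min \<rho> \<sigma>"
    have e: "e > 0" "e \<le> \<rho>" "e \<le> \<sigma>"
      using \<rho>(1) \<sigma>(1) by (simp_all add: e_def)
    have "abs_conv e a"
      by (rule abs_conv_shrink[OF \<rho>(2)]) (use e \<rho>(1) in simp_all)
    moreover have "abs_conv e b"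
      by (rule abs_conv_shrink[OF \<sigma>(2)]) (use e \<sigma>(1) in simp_all)
    ultimately have "abs_conv e (a + b)" "abs_conv e (a * b)"
      using abs_conv_add(1) abs_conv_mult(1) less_imp_le[OF e(1)] by blast+
    with e(1) show ?thesis
      unfolding mfps_converges_iff by blast
  qed
  then show "mfps_converges a \<Longrightarrow> mfps_converges b \<Longrightarrow> mfps_converges (a + b)"
    and "mfps_converges a \<Longrightarrow> mfps_converges b \<Longrightarrow> mfps_converges (a * b)"
    by blast+
qed

lemma mfps_converges_const: "mfps_converges (mfps_const c)"
  and mfps_converges_var: "mfps_converges (mfps_var k)"
  and mfps_converges_0: "mfps_converges 0"
  unfolding mfps_converges_iff mfps_var_def by (rule exI[of _ 1]; simp)+

lemma mfps_converges_sum: "(\<And>i. i \<in> A \<Longrightarrow> mfps_converges (f i)) \<Longrightarrow> mfps_converges (sum f A)"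
  by (induction A rule: infinite_finite_induct) (auto intro: mfps_converges_0 mfps_converges_add)

text \<open>A finite set of exponents fits into a box, over which the sum factors into one geometric
  sum per variable.\<close>

lemma summable_on_geometric_mdeg:
  fixes x :: real
  assumes "0 \<le> x" "x < 1"
  shows "(\<lambda>p :: nat ^ 'n::finite. x ^ mdeg p) summable_on UNIV"
proof (rule nonneg_bounded_partial_sums_imp_summable_on[where C = "(1 / (1 - x)) ^ CARD('n)"])
  show "\<forall>\<^sub>F X in finite_subsets_at_top UNIV. (\<Sum>p :: nat ^ 'n\<in>X. x ^ mdeg p) \<le> (1 / (1 - x)) ^ CARD('n)"
  proof (rule eventually_finite_subsets_at_top_weakI)
    fix X :: "(nat ^ 'n) set" assume X: "finite X"
    obtain n where n: "\<And>p. p \<in> X \<Longrightarrow> mdeg p < n"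
      using finite_nat_set_iff_bounded[of "mdeg ` X"] X by auto
    let ?B = "PiE UNIV (\<lambda>_ :: 'n. {..<n})"
    have inj: "inj_on (\<lambda>p k. p $ k) X"
      by (auto simp: inj_on_def vec_eq_iff fun_eq_iff)
    have "(\<Sum>p\<in>X. x ^ mdeg p) = (\<Sum>p\<in>(\<lambda>p k. p $ k) ` X. \<Prod>k\<in>UNIV. x ^ p k)"
      by (subst sum.reindex[OF inj]) (simp add: mdeg_def power_sum)
    also have "\<dots> \<le> (\<Sum>p\<in>?B. \<Prod>k\<in>UNIV. x ^ p k)"
    proof (rule sum_mono2)
      show "(\<lambda>p k. p $ k) ` X \<subseteq> ?B"
        using n component_le_mdeg by (auto intro: le_less_trans)
    qed (use assms(1) in \<open>auto intro!: finite_PiE prod_nonneg\<close>)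
    also have "\<dots> = (\<Prod>k\<in>(UNIV :: 'n set). \<Sum>i<n. x ^ i)"
      by (subst prod_sum_PiE) auto
    also have "\<dots> \<le> (\<Prod>k\<in>(UNIV :: 'n set). 1 / (1 - x))"
    proof (rule prod_mono)
      have "(\<Sum>i<n. x ^ i) \<le> (\<Sum>i. x ^ i)"
        using assms by (intro sum_le_suminf summable_geometric) auto
      then show "0 \<le> (\<Sum>i<n. x ^ i) \<and> (\<Sum>i<n. x ^ i) \<le> 1 / (1 - x)"
        using assms by (simp add: suminf_geometric sum_nonneg)
    qed
    finally show "(\<Sum>p\<in>X. x ^ mdeg p) \<le> (1 / (1 - x)) ^ CARD('n)"
      by simp
  qed
qed (use assms(1) in auto)

text \<open>A coefficient estimate in one direction, comparison with a geometric series in the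
  other. Component and multi-index form one index, so that the capacity theorem applies to the whole
  map as a single family.\<close>

lemma map_converges_iff_exp_bounded:
  fixes h :: "'n::finite \<Rightarrow> 'n mfps"
  shows "map_converges h \<longleftrightarrow> exp_bounded (\<lambda>i. mdeg (snd i)) (\<lambda>i. coeff_of (h (fst i)) (snd i))"
proof
  assume "map_converges h"
  then obtain \<rho> where \<rho>: "\<rho> > 0" "\<And>k. abs_conv \<rho> (h k)"
    using map_converges_common_radius by blast
  define W where "W = (\<Sum>k\<in>UNIV. wnorm \<rho> (h k))"
  have W0: "W \<ge> 0" and W: "wnorm \<rho> (h k) \<le> W" for k
    using wnorm_nonneg[of \<rho>] \<rho>(1) unfolding W_def by (auto intro!: sum_nonneg member_le_sum)
  \<comment> \<open>Both factors are at least 1, so their powers with exponent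
    \<open>mdeg p + 1\<close> dominate \<open>W\<close> and
    \<open>(1 / \<rho>) ^ mdeg p\<close>.\<close>
  define R where "R = (1 + W) * (1 + 1 / \<rho>)"
  have "norm (coeff_of (h j) p) \<le> R ^ (mdeg p + 1)" for j p
  proof -
    have "norm (coeff_of (h j) p) * \<rho> ^ mdeg p \<le> wnorm \<rho> (h j)"
      unfolding wnorm_def
      using finite_sum_le_infsum[of "\<lambda>p. norm (coeff_of (h j) p) * \<rho> ^ mdeg p" UNIV "{p}"] \<rho>
      by (simp add: abs_conv_def)
    also have "\<dots> \<le> W" by (rule W)
    finally have "norm (coeff_of (h j) p) \<le> W * (1 / \<rho>) ^ mdeg p"
      using \<rho>(1) by (simp add: field_simps)
    also have "\<dots> \<le> (1 + W) ^ (mdeg p + 1) * (1 + 1 / \<rho>) ^ (mdeg p + 1)"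
    proof (rule mult_mono)
      have "1 + W \<le> (1 + W) ^ (mdeg p + 1)"
        using W0 by (intro self_le_power) auto
      then show "W \<le> (1 + W) ^ (mdeg p + 1)" by simp
      have "(1 / \<rho>) ^ mdeg p \<le> (1 + 1 / \<rho>) ^ mdeg p"
        using \<rho>(1) by (intro power_mono) auto
      also have "\<dots> \<le> (1 + 1 / \<rho>) ^ (mdeg p + 1)"
        using \<rho>(1) by (intro power_increasing) auto
      finally show "(1 / \<rho>) ^ mdeg p \<le> (1 + 1 / \<rho>) ^ (mdeg p + 1)" .
    qed (use W0 \<rho>(1) in auto)
    also have "\<dots> = R ^ (mdeg p + 1)"
      by (simp only: R_def power_mult_distrib)
    finally show ?thesis .
  qed
  then show "exp_bounded (\<lambda>i. mdeg (snd i)) (\<lambda>i. coeff_of (h (fst i)) (snd i))"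
    using W0 \<rho>(1) by (intro exp_boundedI[of _ R]) (auto simp: R_def)
next
  assume "exp_bounded (\<lambda>i. mdeg (snd i)) (\<lambda>i. coeff_of (h (fst i)) (snd i))"
  then obtain N :: nat where N: "\<And>j p. norm (coeff_of (h j) p) \<le> real N ^ (mdeg p + 1)"
    unfolding exp_bounded_def by force
  define \<rho> where "\<rho> = 1 / (2 * (real N + 1))"
  have \<rho>: "\<rho> > 0" "real N * \<rho> \<le> 1 / 2"
    by (auto simp: \<rho>_def field_simps)
  have "abs_conv \<rho> (h j)" for j
  proof (rule abs_conv_leI(1))
    show "(\<lambda>p :: nat ^ 'n. real N * (1 / 2) ^ mdeg p) summable_on UNIV"
      by (intro summable_on_cmult_right summable_on_geometric_mdeg) auto
    fix p
    have "norm (coeff_of (h j) p) * \<rho> ^ mdeg p \<le> real N ^ (mdeg p + 1) * \<rho> ^ mdeg p"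
      using N \<rho>(1) by (intro mult_right_mono) auto
    also have "\<dots> = real N * (real N * \<rho>) ^ mdeg p"
      by (simp add: power_mult_distrib)
    also have "\<dots> \<le> real N * (1 / 2) ^ mdeg p"
      using \<rho> by (intro mult_left_mono power_mono) auto
    finally show "norm (coeff_of (h j) p) * \<rho> ^ mdeg p \<le> real N * (1 / 2) ^ mdeg p" .
  qed (use \<rho>(1) in simp)
  with \<rho>(1) show "map_converges h"
    unfolding map_converges_def mfps_converges_iff by blast
qed

theorem theorem4:
  fixes m d l :: nat
    and lam :: "complex ^ 'n::finite"
    and f :: "'n \<Rightarrow> (nat \<Rightarrow> nat) \<Rightarrow> 'n mfps"
    and r :: "nat \<Rightarrow> nat ^ 'n"
    and h :: "(nat \<Rightarrow> complex) \<Rightarrow> 'n \<Rightarrow> 'n mfps"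
    and C0 C1 :: real
  assumes "m \<ge> 1" and "d \<ge> 1"
    and f_holomorphic: "\<And>j i. i \<in> multiindices m \<Longrightarrow> 1 \<le> ideg m i \<Longrightarrow> ideg m i \<le> d \<Longrightarrow>
          mfps_converges (f j i)"
    and f_order: "\<And>j i p. i \<in> multiindices m \<Longrightarrow> 1 \<le> ideg m i \<Longrightarrow> ideg m i \<le> d \<Longrightarrow>
          mdeg p < 2 \<Longrightarrow> coeff_of (f j i) p = 0"
    and siegel: "0 \<in> convex hull (range (\<lambda>j. lam $ j))"
    and resonant: "\<exists>q j. resonance lam q j"
    and r_nonzero: "\<And>s. s \<in> {1..l} \<Longrightarrow> r s \<noteq> 0"
    and r_weight: "\<And>s. s \<in> {1..l} \<Longrightarrow> weight (r s) lam = 0"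
    and r_generate: "resonances_generated lam l r"
    and normalization: "\<And>t. t \<in> cspace m \<Longrightarrow>
          formal_normalization lam l r (vector_field m d lam f t) (h t)"
    and "C0 > 0" and "C1 > 0"
    and polynomial: "\<And>j p. polynomial_of_degree_le m (C0 + C1 * real (mdeg p))
          (\<lambda>t. coeff_of (h t j) p)"
  shows "(\<forall>t\<in>cspace m. map_converges (h t) \<and>
            locally_invariant (map_eval (vector_field m d lam f t))
              {z. \<forall>s\<in>{1..l}. mpower (map_eval (h t) z) (r s) = 0}) \<or>
         (\<exists>E\<subseteq>cspace m. Gamma_capacity m E = 0 \<and>
            (\<forall>t\<in>cspace m - E. \<not> map_converges (h t)))"
proof (cases "Gamma_capacity m {t \<in> cspace m. map_converges (h t)} = 0")
  case True
  \<comment> \<open>The exceptional set is the set of convergence itself.\<close>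
  then show ?thesis
    by (intro disjI2 exI[of _ "{t \<in> cspace m. map_converges (h t)}"]) auto
next
  case False
  have conv: "map_converges (h t)" if "t \<in> cspace m" for t
  proof -
    have "exp_bounded (\<lambda>i. mdeg (snd i)) (\<lambda>i. coeff_of (h t (fst i)) (snd i))"
      by (rule exp_bounded_of_Gamma_capacity[where \<Phi> = "\<lambda>i t. coeff_of (h t (fst i)) (snd i)",
            OF polynomial \<open>C0 > 0\<close> \<open>C1 > 0\<close> _ _ False that])
        (auto simp: map_converges_iff_exp_bounded)
    then show ?thesis
      by (simp add: map_converges_iff_exp_bounded)
  qed
  have "map_converges (vector_field m d lam f t)" for t
    unfolding map_converges_def vector_field_def
    by (intro allI mfps_converges_add mfps_converges_sum mfps_converges_mult mfps_converges_const
        mfps_converges_var f_holomorphic) auto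
  then show ?thesis
    using conv locally_invariant_resonant_variety[OF normalization] by blast
qed

end
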